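(* Let $d\ge 1$, let $m_S,\widehat{m_F}\in L^2(\mathbb{R}^d)$, and let $\mathcal{K}$ be the associated generalized concentration operator on $L^2(\mathbb{R}^d)$. Then: (a) $\mathcal{K}$ is a Hilbert–Schmidt operator, self-adjoint, compact, and positive semi-definite. (b) The countable family $\{\psi_i\}_{i=1}^\infty$ of eigenfunctions of $\mathcal{K}$ is orthonormal for the usual $L^2(\mathbb{R}^d)$ inner product and complete in $L^2(\mathbb{R}^d)$ (that is, there is an orthonormal basis of $L^2(\mathbb{R}^d)$ made of eigenfunctions $\psi_i$ of $\mathcal{K}$). The associated eigenvalues $\{\lambda_i\}_{i=1}^\infty$ are real and nonnegative, and they can be ordered so that $\lambda_i\ge\lambda_{i+1}\ge 0$ for all $i\ge 1$. (c) The orthonormal basis of eigenfunctions $\{\psi_i\}_{i=1}^\infty$ (ordered as in (b)) consists of critical points of the concentration ratio $\nu$, and can be obtained by the successive maximization problems $$\lambda_n=\sup_{\substack{f\in L^2(\mathbb{R}^d)\\ f\in[\psi_1,\dots,\psi_{n-1}]^\perp}}\frac{(\mathcal{K}f,f)_{L^2}}{(f,f)_{L^2}},$$ where $[\psi_1,\dots,\psi_{n-1}]^\perp:=\{u\in L^2(\mathbb{R}^d):(u,\psi_i)_{L^2}=0,\ i=1,\dots,n-1\}$. (d) For large $n$, $\lambda_n=o(n^{-1/2})$. (e) If $|\widehat{m_F}|^2$ is even and $m_S$ is real, then $\mathcal{K}$ is real-valued for real inputs (i.e. $\mathcal{K}f$ is real-valued whenever $f$ is).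
   Context: The Fourier transform is $\mathcal{F}[f](\xi)=\int_{\mathbb{R}^d}f(x)e^{-i\xi\cdot x}dx$ with inverse $\mathcal{F}^{-1}[f](x)=(2\pi)^{-d}\int_{\mathbb{R}^d}f(\xi)e^{ix\cdot\xi}d\xi$. $(\cdot,\cdot)_{L^2}$ is the usual $L^2(\mathbb{R}^d)$ inner product, antilinear in its second argument. Given a space mask $m_S$ and a Fourier mask $\widehat{m_F}$ in $L^2(\mathbb{R}^d)$, set $\mathcal{M}_Sf=m_Sf$ and $\mathcal{M}_Ff=\mathcal{F}^{-1}[\widehat{m_F}\,\mathcal{F}[f]]$. The generalized concentration operator is $\mathcal{K}=\mathcal{M}_S^*\mathcal{M}_F^*\mathcal{M}_F\mathcal{M}_S$, i.e. $$(\mathcal{K}f)(x)=\overline{m_S(x)}\int_{\mathbb{R}^d}k(x-y)\,m_S(y)f(y)\,dy,\qquad k(z)=\frac{1}{(2\pi)^d}\int_{\mathbb{R}^d}e^{i\xi\cdot z}|\widehat{m_F}(\xi)|^2d\xi .$$ The concentration ratio of a nonzero $f\in L^2(\mathbb{R}^d)$ is $\nu(f)=\dfrac{\|\mathcal{M}_F\mathcal{M}_Sf\|_{L^2}^2}{\|f\|_{L^2}^2}=\dfrac{(\mathcal{K}f,f)_{L^2}}{(f,f)_{L^2}}$. Suprema of such ratios are over nonzero $f$.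
   Formalization: In (b)–(d) the decreasing list λ_1≥λ_2≥… contains all nonzero eigenvalues but may omit ψ_i with eigenvalue 0 when infinitely many are positive, as the whole basis then cannot be so ordered (e.g. interval indicators as masks); it is the whole basis whenever such an ordering exists. *)

theory Defs
  imports "HOL-Probability.Probability" "HOL-Library.Landau_Symbols"
begin

section \<open>The space of square-integrable functions\<close>

text \<open>Elements are functions, not classes of functions; equality and non-vanishing of elements are
  therefore always expressed almost everywhere.  Every Lebesgue measurable function agrees almost
  everywhere with a Borel measurable one, so working over \<^const>\<open>lborel\<close> gives the usual space.\<close>

definition l2_space :: "(real ^ 'd::finite \<Rightarrow> complex) set" where
  "l2_space = {f \<in> borel_measurable lborel. integrable lborel (\<lambda>x. (cmod (f x))\<^sup>2)}"

definition l2_eq :: "(real ^ 'd::finite \<Rightarrow> complex) \<Rightarrow> (real ^ 'd \<Rightarrow> complex) \<Rightarrow> bool" where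
  "l2_eq f g \<longleftrightarrow> (AE x in lborel. f x = g x)"

definition l2_inner :: "(real ^ 'd::finite \<Rightarrow> complex) \<Rightarrow> (real ^ 'd \<Rightarrow> complex) \<Rightarrow> complex" where
  "l2_inner f g = (LINT x|lborel. f x * cnj (g x))"

definition l2_norm :: "(real ^ 'd::finite \<Rightarrow> complex) \<Rightarrow> real" where
  "l2_norm f = sqrt (LINT x|lborel. (cmod (f x))\<^sup>2)"

definition l2_nonzero :: "(real ^ 'd::finite \<Rightarrow> complex) set" where
  "l2_nonzero = {f \<in> l2_space. \<not> l2_eq f (\<lambda>x. 0)}"

definition l2_orth :: "(real ^ 'd::finite \<Rightarrow> complex) set \<Rightarrow> (real ^ 'd \<Rightarrow> complex) set" where
  "l2_orth G = {u \<in> l2_space. \<forall>g\<in>G. l2_inner u g = 0}"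

definition l2_orthonormal_basis :: "(nat \<Rightarrow> real ^ 'd::finite \<Rightarrow> complex) \<Rightarrow> bool" where
  "l2_orthonormal_basis e \<longleftrightarrow>
     (\<forall>i. e i \<in> l2_space) \<and>
     (\<forall>i j. l2_inner (e i) (e j) = (if i = j then 1 else 0)) \<and>
     (\<forall>f\<in>l2_space. \<forall>\<epsilon>>0. \<exists>N c. l2_norm (\<lambda>x. f x - (\<Sum>i<N. c i * e i x)) < \<epsilon>)"


section \<open>Operators and functionals\<close>

definition l2_bounded_linear ::
    "((real ^ 'd::finite \<Rightarrow> complex) \<Rightarrow> (real ^ 'd \<Rightarrow> complex)) \<Rightarrow> bool" where
  "l2_bounded_linear T \<longleftrightarrow>
     (\<forall>f\<in>l2_space. T f \<in> l2_space) \<and>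
     (\<forall>f\<in>l2_space. \<forall>g\<in>l2_space. l2_eq (T (\<lambda>x. f x + g x)) (\<lambda>x. T f x + T g x)) \<and>
     (\<forall>f\<in>l2_space. \<forall>c. l2_eq (T (\<lambda>x. c * f x)) (\<lambda>x. c * T f x)) \<and>
     (\<exists>C. \<forall>f\<in>l2_space. l2_norm (T f) \<le> C * l2_norm f)"

definition l2_hilbert_schmidt ::
    "((real ^ 'd::finite \<Rightarrow> complex) \<Rightarrow> (real ^ 'd \<Rightarrow> complex)) \<Rightarrow> bool" where
  "l2_hilbert_schmidt T \<longleftrightarrow>
     l2_bounded_linear T \<and>
     (\<exists>e. l2_orthonormal_basis e \<and> summable (\<lambda>i. (l2_norm (T (e i)))\<^sup>2))"

definition l2_self_adjoint ::
    "((real ^ 'd::finite \<Rightarrow> complex) \<Rightarrow> (real ^ 'd \<Rightarrow> complex)) \<Rightarrow> bool" where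
  "l2_self_adjoint T \<longleftrightarrow>
     l2_bounded_linear T \<and>
     (\<forall>f\<in>l2_space. \<forall>g\<in>l2_space. l2_inner (T f) g = l2_inner f (T g))"

definition l2_compact ::
    "((real ^ 'd::finite \<Rightarrow> complex) \<Rightarrow> (real ^ 'd \<Rightarrow> complex)) \<Rightarrow> bool" where
  "l2_compact T \<longleftrightarrow>
     l2_bounded_linear T \<and>
     (\<forall>F. (\<forall>i::nat. F i \<in> l2_space) \<and> (\<exists>C. \<forall>i. l2_norm (F i) \<le> C) \<longrightarrow>
        (\<exists>g\<in>l2_space. \<exists>r. strict_mono r \<and>
           (\<lambda>i. l2_norm (\<lambda>x. T (F (r i)) x - g x)) \<longlonglongrightarrow> 0))"

definition l2_pos_semidef ::
    "((real ^ 'd::finite \<Rightarrow> complex) \<Rightarrow> (real ^ 'd \<Rightarrow> complex)) \<Rightarrow> bool" where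
  "l2_pos_semidef T \<longleftrightarrow>
     (\<forall>f\<in>l2_space. l2_inner (T f) f \<in> \<real> \<and> 0 \<le> Re (l2_inner (T f) f))"

definition l2_eigenfunction ::
    "((real ^ 'd::finite \<Rightarrow> complex) \<Rightarrow> (real ^ 'd \<Rightarrow> complex)) \<Rightarrow> complex \<Rightarrow>
     (real ^ 'd \<Rightarrow> complex) \<Rightarrow> bool" where
  "l2_eigenfunction T c f \<longleftrightarrow> f \<in> l2_nonzero \<and> l2_eq (T f) (\<lambda>x. c * f x)"

definition l2_eigenbasis ::
    "((real ^ 'd::finite \<Rightarrow> complex) \<Rightarrow> (real ^ 'd \<Rightarrow> complex)) \<Rightarrow>
     (nat \<Rightarrow> real ^ 'd \<Rightarrow> complex) \<Rightarrow> (nat \<Rightarrow> real) \<Rightarrow> bool" where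
  "l2_eigenbasis T \<psi> \<mu> \<longleftrightarrow>
     l2_orthonormal_basis \<psi> \<and> (\<forall>i. l2_eigenfunction T (complex_of_real (\<mu> i)) (\<psi> i))"

text \<open>A critical point is a point where the Frechet derivative exists and vanishes (the space being
  viewed as a real normed space).\<close>

definition l2_critical_point ::
    "((real ^ 'd::finite \<Rightarrow> complex) \<Rightarrow> real) \<Rightarrow> (real ^ 'd \<Rightarrow> complex) \<Rightarrow> bool" where
  "l2_critical_point \<Phi> f \<longleftrightarrow>
     f \<in> l2_nonzero \<and>
     (\<forall>\<epsilon>>0. \<exists>\<delta>>0. \<forall>h\<in>l2_space. l2_norm h < \<delta> \<longrightarrow>
        \<bar>\<Phi> (\<lambda>x. f x + h x) - \<Phi> f\<bar> \<le> \<epsilon> * l2_norm h)"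

text \<open>Listing eigenvalues in decreasing order: \<open>\<sigma> n\<close> is the index of the \<open>n\<close>-th largest eigenvalue,
  counted with multiplicity and starting at \<open>n = 0\<close>.  Every index carrying a nonzero eigenvalue is
  listed.  Indices with eigenvalue zero may be left out, and sometimes have to be: when infinitely
  many eigenvalues are positive and zero is an eigenvalue as well (for instance if both masks are
  indicators of bounded boxes), no decreasing sequence lists all of them.  If \<open>\<sigma>\<close> is surjective, the whole
  basis is ordered.\<close>

definition decreasing_order :: "(nat \<Rightarrow> real) \<Rightarrow> (nat \<Rightarrow> nat) \<Rightarrow> bool" where
  "decreasing_order \<mu> \<sigma> \<longleftrightarrow> inj \<sigma> \<and> {i. \<mu> i \<noteq> 0} \<subseteq> range \<sigma> \<and> decseq (\<mu> \<circ> \<sigma>)"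


section \<open>The generalized concentration operator\<close>

definition conc_kernel :: "(real ^ 'd::finite \<Rightarrow> complex) \<Rightarrow> real ^ 'd \<Rightarrow> complex" where
  "conc_kernel mF z =
     1 / (2 * pi) ^ CARD('d) *
     (LINT \<xi>|lborel. exp (\<i> * complex_of_real (\<xi> \<bullet> z)) * complex_of_real ((cmod (mF \<xi>))\<^sup>2))"

definition conc_op :: "(real ^ 'd::finite \<Rightarrow> complex) \<Rightarrow> (real ^ 'd \<Rightarrow> complex) \<Rightarrow>
    (real ^ 'd \<Rightarrow> complex) \<Rightarrow> real ^ 'd \<Rightarrow> complex" where
  "conc_op mS mF f x = cnj (mS x) * (LINT y|lborel. conc_kernel mF (x - y) * mS y * f y)"

text \<open>The quotient is real because the operator is self-adjoint; \<^const>\<open>Re\<close> only changes the type.\<close>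

definition conc_ratio :: "(real ^ 'd::finite \<Rightarrow> complex) \<Rightarrow> (real ^ 'd \<Rightarrow> complex) \<Rightarrow>
    (real ^ 'd \<Rightarrow> complex) \<Rightarrow> real" where
  "conc_ratio mS mF f = Re (l2_inner (conc_op mS mF f) f / l2_inner f f)"

end

theory Submission
  imports Defs "HOL-Complex_Analysis.Great_Picard"
begin

text \<open>
  The operator has the kernel \<open>cnj (mS x) * k (x - y) * mS y\<close> with \<open>k\<close> bounded, so its sections are
  square integrable with norm at most a multiple of \<open>\<bar>mS x\<bar>\<close>.  Hence it maps weakly convergent
  sequences to dominated, pointwise convergent ones, which gives compactness, and Bessel's
  inequality applied to the sections, integrated over \<open>x\<close>, bounds the Hilbert-Schmidt norm.  Fubini's
  theorem gives self-adjointness and, after inserting the Fourier integral for \<open>k\<close>, positivity;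
  Plancherel's theorem is not needed.

  For a compact positive operator, Zorn's lemma yields a maximal orthonormal set of eigenfunctions.
  It is total, because the quadratic form attains its supremum on the unit sphere of the
  orthogonal complement of a set of eigenfunctions, and it is countably infinite, because the space
  is separable and infinite-dimensional.  The variational characterisation, criticality and the
  decay \<open>n * \<mu> n ^ 2 \<longlonglongrightarrow> 0\<close> of a decreasing square-summable sequence then follow from Parseval's
  identity in this basis.
\<close>

section \<open>Square-integrable functions\<close>

text \<open>Elements are functions rather than classes modulo null sets, so \<open>l2_norm\<close>
  is only a seminorm and eigenvalue equations hold almost everywhere; \<open>l2_inner_cong\<close>
  and \<open>l2_norm_cong\<close> carry such equations into inner products and norms. Maximality
  ranges over all orthonormal sets of eigenfunctions, so the null space of the operator is treated
  like any other eigenspace; extracting maximisers one after another could stay among the positive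
  eigenvalues for ever and miss it. The price is a basis in no particular order. The order is
  therefore a separate map \<sigma>, which may leave out zero eigenvalues. The same existence lemma
  with a trivial condition gives some basis before any operator is considered; the selection of
  weakly convergent subsequences, and hence compactness, rests on that basis. The recurring constant
  \<open>(l2_norm mF)\<^sup>2 / (2 * pi) ^ CARD('d)\<close> bounds the kernel: a Fourier integral is
  at most the L1 norm of its density, here the squared modulus of \<open>mF\<close>. The exponent
  -1/2 of the decay is what square-summability of the eigenvalues gives.\<close>

lemma borel_measurable_cnj [measurable (raw)]:
  "f \<in> borel_measurable M \<Longrightarrow> (\<lambda>x. cnj (f x)) \<in> borel_measurable M"
  by (rule borel_measurable_continuous_on[OF continuous_on_cnj[OF continuous_on_id]])

lemma l2_measurable: "f \<in> l2_space \<Longrightarrow> f \<in> borel_measurable borel"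
  by (simp add: l2_space_def)

lemma l2_integrable_norm2: "f \<in> l2_space \<Longrightarrow> integrable lborel (\<lambda>x. (cmod (f x))\<^sup>2)"
  by (simp add: l2_space_def)

lemma l2_spaceI:
  "f \<in> borel_measurable borel \<Longrightarrow> integrable lborel (\<lambda>x. (cmod (f x))\<^sup>2) \<Longrightarrow> f \<in> l2_space"
  by (simp add: l2_space_def)

lemma l2_zero [simp]: "(\<lambda>x. 0) \<in> l2_space"
  by (simp add: l2_space_def)

lemma l2_scale [simp]: "f \<in> l2_space \<Longrightarrow> (\<lambda>x. c * f x) \<in> l2_space"
  by (auto simp: l2_space_def norm_mult power_mult_distrib)

lemma l2_add [simp]:
  assumes "f \<in> l2_space" "g \<in> l2_space"
  shows "(\<lambda>x. f x + g x) \<in> l2_space"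
proof (rule l2_spaceI)
  note [measurable] = assms[THEN l2_measurable]
  show "(\<lambda>x. f x + g x) \<in> borel_measurable borel" by measurable
  have *: "(cmod (a + b))\<^sup>2 \<le> 2 * (cmod a)\<^sup>2 + 2 * (cmod b)\<^sup>2" for a b :: complex
    using power_mono[OF norm_triangle_ineq[of a b], of 2] sum_squares_bound[of "cmod a" "cmod b"]
    by (simp add: power2_sum)
  have int: "integrable lborel (\<lambda>x. 2 * (cmod (f x))\<^sup>2 + 2 * (cmod (g x))\<^sup>2)"
    using assms by (auto intro!: l2_integrable_norm2)
  show "integrable lborel (\<lambda>x. (cmod (f x + g x))\<^sup>2)"
    by (rule Bochner_Integration.integrable_bound[OF int]) (auto simp: *)
qed

lemma l2_uminus [simp]: "f \<in> l2_space \<Longrightarrow> (\<lambda>x. - f x) \<in> l2_space"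
  using l2_scale[of f "-1"] by simp

lemma l2_diff [simp]: "f \<in> l2_space \<Longrightarrow> g \<in> l2_space \<Longrightarrow> (\<lambda>x. f x - g x) \<in> l2_space"
  using l2_add[of f "\<lambda>x. - g x"] by simp

lemma l2_sum [simp]:
  "(\<And>i. i \<in> I \<Longrightarrow> f i \<in> l2_space) \<Longrightarrow> (\<lambda>x. \<Sum>i\<in>I. f i x) \<in> l2_space"
  by (induction I rule: infinite_finite_induct) auto

lemma l2_cnj [simp]: "f \<in> l2_space \<Longrightarrow> (\<lambda>x. cnj (f x)) \<in> l2_space"
  by (auto simp: l2_space_def intro: borel_measurable_cnj)

lemma l2_integrable_mult:
  assumes "f \<in> l2_space" "g \<in> l2_space"
  shows "integrable lborel (\<lambda>x. f x * g x)"
proof -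
  note [measurable] = assms[THEN l2_measurable]
  have int: "integrable lborel (\<lambda>x. (cmod (f x))\<^sup>2 + (cmod (g x))\<^sup>2)"
    using assms by (auto intro!: l2_integrable_norm2)
  have *: "a * b \<le> a\<^sup>2 + b\<^sup>2" if "a \<ge> 0" "b \<ge> 0" for a b :: real
    using sum_squares_bound[of a b] mult_nonneg_nonneg[OF that] by linarith
  show ?thesis
    by (rule Bochner_Integration.integrable_bound[OF int]) (auto simp: norm_mult *)
qed

lemma l2_integrable_inner:
  "f \<in> l2_space \<Longrightarrow> g \<in> l2_space \<Longrightarrow> integrable lborel (\<lambda>x. f x * cnj (g x))"
  by (rule l2_integrable_mult) auto

lemma l2_inner_commute: "l2_inner g f = cnj (l2_inner f g)"
  using Bochner_Integration.integral_cnj[of lborel "\<lambda>x. f x * cnj (g x)"] by (simp add: l2_inner_def mult.commute)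

section \<open>Sesquilinearity of the inner product\<close>

lemma l2_inner_add_left:
  "f \<in> l2_space \<Longrightarrow> g \<in> l2_space \<Longrightarrow> h \<in> l2_space \<Longrightarrow>
    l2_inner (\<lambda>x. f x + g x) h = l2_inner f h + l2_inner g h"
  by (simp add: l2_inner_def distrib_right l2_integrable_inner)

lemma l2_inner_diff_left:
  "f \<in> l2_space \<Longrightarrow> g \<in> l2_space \<Longrightarrow> h \<in> l2_space \<Longrightarrow>
    l2_inner (\<lambda>x. f x - g x) h = l2_inner f h - l2_inner g h"
  by (simp add: l2_inner_def left_diff_distrib l2_integrable_inner)

lemma l2_inner_scale_left: "l2_inner (\<lambda>x. c * f x) h = c * l2_inner f h"
  by (simp add: l2_inner_def mult.assoc)

lemma l2_inner_zero_left: "l2_inner (\<lambda>x. 0) h = 0"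
  by (simp add: l2_inner_def)

lemma l2_inner_sum_left:
  "(\<And>i. i \<in> I \<Longrightarrow> f i \<in> l2_space) \<Longrightarrow> h \<in> l2_space \<Longrightarrow>
    l2_inner (\<lambda>x. \<Sum>i\<in>I. f i x) h = (\<Sum>i\<in>I. l2_inner (f i) h)"
  by (induction I rule: infinite_finite_induct) (auto simp: l2_inner_zero_left l2_inner_add_left)

lemma l2_inner_add_right:
  "f \<in> l2_space \<Longrightarrow> g \<in> l2_space \<Longrightarrow> h \<in> l2_space \<Longrightarrow>
    l2_inner h (\<lambda>x. f x + g x) = l2_inner h f + l2_inner h g"
  by (simp add: l2_inner_commute[of h] l2_inner_add_left)

lemma l2_inner_diff_right:
  "f \<in> l2_space \<Longrightarrow> g \<in> l2_space \<Longrightarrow> h \<in> l2_space \<Longrightarrow>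
    l2_inner h (\<lambda>x. f x - g x) = l2_inner h f - l2_inner h g"
  by (simp add: l2_inner_commute[of h] l2_inner_diff_left)

lemma l2_inner_scale_right: "l2_inner h (\<lambda>x. c * f x) = cnj c * l2_inner h f"
  by (simp add: l2_inner_commute[of h] l2_inner_scale_left)

lemma l2_inner_zero_right: "l2_inner h (\<lambda>x. 0) = 0"
  by (simp add: l2_inner_def)

lemma l2_inner_sum_right:
  "(\<And>i. i \<in> I \<Longrightarrow> f i \<in> l2_space) \<Longrightarrow> h \<in> l2_space \<Longrightarrow>
    l2_inner h (\<lambda>x. \<Sum>i\<in>I. f i x) = (\<Sum>i\<in>I. l2_inner h (f i))"
  by (simp add: l2_inner_commute[of h] l2_inner_sum_left)

lemmas l2_inner_simps =
  l2_inner_add_left l2_inner_add_right l2_inner_diff_left l2_inner_diff_right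
  l2_inner_scale_left l2_inner_scale_right l2_inner_sum_left l2_inner_sum_right
  l2_inner_zero_left l2_inner_zero_right

lemma l2_inner_cong:
  assumes "l2_eq f f'" "l2_eq g g'" "f \<in> l2_space" "f' \<in> l2_space" "g \<in> l2_space" "g' \<in> l2_space"
  shows "l2_inner f g = l2_inner f' g'"
proof -
  note [measurable] = assms(3-6)[THEN l2_measurable]
  have "AE x in lborel. f x * cnj (g x) = f' x * cnj (g' x)"
    using assms(1,2) unfolding l2_eq_def by eventually_elim simp
  then show ?thesis
    unfolding l2_inner_def by (intro integral_cong_AE) measurable
qed

section \<open>The seminorm and the Cauchy-Schwarz inequality\<close>

lemma l2_norm_nonneg [simp]: "0 \<le> l2_norm f"
  by (simp add: l2_norm_def)

lemma l2_norm_power2: "(l2_norm f)\<^sup>2 = (LINT x|lborel. (cmod (f x))\<^sup>2)"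
  by (simp add: l2_norm_def)

lemma l2_inner_self: "l2_inner f f = complex_of_real ((l2_norm f)\<^sup>2)"
  by (simp add: l2_inner_def l2_norm_power2 complex_norm_square[symmetric] del: of_real_power)

lemma Re_l2_inner_self: "Re (l2_inner f f) = (l2_norm f)\<^sup>2"
  unfolding l2_inner_self by simp

lemma l2_norm_cong:
  "l2_eq f g \<Longrightarrow> f \<in> l2_space \<Longrightarrow> g \<in> l2_space \<Longrightarrow> l2_norm f = l2_norm g"
  using l2_inner_cong[of f g f g] Re_l2_inner_self[of f] Re_l2_inner_self[of g] by simp

lemma l2_norm_scale: "l2_norm (\<lambda>x. c * f x) = cmod c * l2_norm f"
  by (simp add: l2_norm_def norm_mult power_mult_distrib real_sqrt_mult)

lemma l2_norm_minus_commute: "l2_norm (\<lambda>x. f x - g x) = l2_norm (\<lambda>x. g x - f x)"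
  by (simp add: l2_norm_def norm_minus_commute)

lemma l2_norm_zero [simp]: "l2_norm (\<lambda>x. 0) = 0"
  by (simp add: l2_norm_def)

lemma l2_norm_eq_0_iff:
  assumes "f \<in> l2_space"
  shows "l2_norm f = 0 \<longleftrightarrow> l2_eq f (\<lambda>x. 0)"
proof -
  have "l2_norm f = 0 \<longleftrightarrow> (AE x in lborel. (cmod (f x))\<^sup>2 = 0)"
    unfolding l2_norm_def real_sqrt_eq_0_iff
    by (rule integral_nonneg_eq_0_iff_AE[OF l2_integrable_norm2[OF assms]]) simp
  then show ?thesis by (simp add: l2_eq_def)
qed

lemma l2_nonzero_iff: "f \<in> l2_nonzero \<longleftrightarrow> f \<in> l2_space \<and> 0 < l2_norm f"
  using l2_norm_eq_0_iff[of f] l2_norm_nonneg[of f] by (auto simp: l2_nonzero_def less_le)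

lemma l2_eq_iff_norm_diff:
  "f \<in> l2_space \<Longrightarrow> g \<in> l2_space \<Longrightarrow> l2_eq f g \<longleftrightarrow> l2_norm (\<lambda>x. f x - g x) = 0"
  by (subst l2_norm_eq_0_iff) (auto simp: l2_eq_def)

text \<open>Source of the norm computations below: \<open>c = -1\<close> gives the norm of a sum,
  \<open>c = 1\<close> the residual of a projection, a real multiple of \<open>l2_inner f g\<close>
  the Cauchy-Schwarz inequality, and an eigenvalue candidate the residual of the eigenvalue
  equation.\<close>

lemma l2_norm_diff_scale_power2:
  assumes "f \<in> l2_space" "g \<in> l2_space"
  shows "(l2_norm (\<lambda>x. f x - c * g x))\<^sup>2 =
    (l2_norm f)\<^sup>2 - 2 * Re (cnj c * l2_inner f g) + (cmod c)\<^sup>2 * (l2_norm g)\<^sup>2"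
proof -
  have "c * (cnj c * l2_inner g g) = complex_of_real ((cmod c)\<^sup>2 * (l2_norm g)\<^sup>2)"
    by (simp only: l2_inner_self mult.assoc[symmetric] complex_norm_square[symmetric] of_real_mult)
  moreover have "c * l2_inner g f = cnj (cnj c * l2_inner f g)"
    by (simp add: l2_inner_commute[of g f])
  ultimately show ?thesis
    using assms
    by (simp add: Re_l2_inner_self[symmetric] l2_inner_simps right_diff_distrib
        del: of_real_power of_real_mult complex_cnj_mult mult_cancel_left)
qed

lemma l2_norm_add_power2:
  assumes "f \<in> l2_space" "g \<in> l2_space"
  shows "(l2_norm (\<lambda>x. f x + g x))\<^sup>2 = (l2_norm f)\<^sup>2 + 2 * Re (l2_inner f g) + (l2_norm g)\<^sup>2"
  using l2_norm_diff_scale_power2[OF assms, of "-1"] by simp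

theorem l2_Cauchy_Schwarz:
  assumes "f \<in> l2_space" "g \<in> l2_space"
  shows "cmod (l2_inner f g) \<le> l2_norm f * l2_norm g"
proof -
  define a where "a = (cmod (l2_inner f g))\<^sup>2"
  \<comment> \<open>Nonnegativity of the squared norm of \<open>f - t * l2_inner f g * g\<close>;
    having the inner product in the multiplier makes the cross term real.\<close>
  have *: "0 \<le> (l2_norm f)\<^sup>2 - 2 * t * a + t\<^sup>2 * a * (l2_norm g)\<^sup>2" for t
  proof -
    have "cnj (complex_of_real t * l2_inner f g) * l2_inner f g = complex_of_real (t * a)"
      unfolding a_def of_real_mult complex_norm_square by simp
    then have "Re (cnj (complex_of_real t * l2_inner f g) * l2_inner f g) = t * a"
      by (simp only: Re_complex_of_real)
    then have "(l2_norm (\<lambda>x. f x - complex_of_real t * l2_inner f g * g x))\<^sup>2 =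
        (l2_norm f)\<^sup>2 - 2 * t * a + t\<^sup>2 * a * (l2_norm g)\<^sup>2"
      unfolding l2_norm_diff_scale_power2[OF assms]
      by (simp add: norm_mult power_mult_distrib a_def del: complex_cnj_mult)
    then show ?thesis by (metis zero_le_power2)
  qed
  have "a \<le> (l2_norm f)\<^sup>2 * (l2_norm g)\<^sup>2"
  proof (cases "l2_norm g = 0")
    case True
    have "a \<le> 0"
    proof (rule ccontr)
      assume "\<not> a \<le> 0"
      \<comment> \<open>If \<open>g\<close> has norm zero, only
        \<open>(l2_norm f)\<^sup>2 - 2 * t * a\<close> remains, and this \<open>t\<close> makes it
        -1.\<close>
      then show False
        using *[of "((l2_norm f)\<^sup>2 + 1) / (2 * a)"] True by simp
    qed
    with True show ?thesis by simp
  next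
    case False
    define q where "q = (l2_norm g)\<^sup>2"
    have "0 < q" using False by (simp add: q_def)
    \<comment> \<open>The value \<open>1 / q\<close> minimises the quadratic in
      \<open>t\<close>.\<close>
    then have "(1 / q)\<^sup>2 * a * q = a / q"
      by (simp add: power2_eq_square)
    then have "0 \<le> (l2_norm f)\<^sup>2 - a / q"
      using *[of "1 / q"] unfolding q_def[symmetric] by simp
    then show ?thesis
      using \<open>0 < q\<close> unfolding q_def[symmetric] by (simp add: field_simps)
  qed
  then show ?thesis
    unfolding a_def by (simp add: power_mult_distrib[symmetric] power2_le_iff_abs_le)
qed

lemma l2_norm_triangle:
  assumes "f \<in> l2_space" "g \<in> l2_space"
  shows "l2_norm (\<lambda>x. f x + g x) \<le> l2_norm f + l2_norm g"
proof (rule power2_le_imp_le)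
  have "Re (l2_inner f g) \<le> l2_norm f * l2_norm g"
    using complex_Re_le_cmod[of "l2_inner f g"] l2_Cauchy_Schwarz[OF assms] by linarith
  then show "(l2_norm (\<lambda>x. f x + g x))\<^sup>2 \<le> (l2_norm f + l2_norm g)\<^sup>2"
    unfolding l2_norm_add_power2[OF assms] by (simp add: power2_sum)
qed simp

lemma l2_norm_triangle_diff:
  assumes "f \<in> l2_space" "g \<in> l2_space" "h \<in> l2_space"
  shows "l2_norm (\<lambda>x. f x - h x) \<le> l2_norm (\<lambda>x. f x - g x) + l2_norm (\<lambda>x. g x - h x)"
  using l2_norm_triangle[of "\<lambda>x. f x - g x" "\<lambda>x. g x - h x"] assms by simp

section \<open>Norm limits and completeness\<close>

lemma l2_inner_tendsto:
  assumes "\<And>n. F n \<in> l2_space" "f \<in> l2_space" "g \<in> l2_space"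
    and lim: "(\<lambda>n. l2_norm (\<lambda>x. F n x - f x)) \<longlonglongrightarrow> 0"
  shows "(\<lambda>n. l2_inner (F n) g) \<longlonglongrightarrow> l2_inner f g"
proof (rule Lim_null_comparison[THEN Lim_null[THEN iffD2]])
  show "\<forall>\<^sub>F n in sequentially. norm (l2_inner (F n) g - l2_inner f g) \<le>
      l2_norm (\<lambda>x. F n x - f x) * l2_norm g"
    using l2_Cauchy_Schwarz[of "\<lambda>x. F _ x - f x" g] assms by (simp add: l2_inner_simps)
  show "(\<lambda>n. l2_norm (\<lambda>x. F n x - f x) * l2_norm g) \<longlonglongrightarrow> 0"
    using tendsto_mult_left_zero[OF lim] .
qed

lemma l2_norm_tendsto:
  assumes "\<And>n. F n \<in> l2_space" "f \<in> l2_space"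
    and lim: "(\<lambda>n. l2_norm (\<lambda>x. F n x - f x)) \<longlonglongrightarrow> 0"
  shows "(\<lambda>n. l2_norm (F n)) \<longlonglongrightarrow> l2_norm f"
proof (rule Lim_null_comparison[THEN Lim_null[THEN iffD2]])
  have "\<bar>l2_norm (F n) - l2_norm f\<bar> \<le> l2_norm (\<lambda>x. F n x - f x)" for n
    using l2_norm_triangle_diff[of "F n" f "\<lambda>x. 0"] l2_norm_triangle_diff[of f "F n" "\<lambda>x. 0"]
      l2_norm_minus_commute[of f "F n"] assms by auto
  then show "\<forall>\<^sub>F n in sequentially. norm (l2_norm (F n) - l2_norm f) \<le> l2_norm (\<lambda>x. F n x - f x)"
    by simp
qed (rule lim)

text \<open>Along a fast subsequence with increments \<open>D k\<close>, the integral of \<open>\<Sum>k. 2 ^ k * (D k)\<^sup>2\<close> is finite;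
  the weights force \<open>\<Sum>k. D k\<close> to converge almost everywhere.\<close>

lemma l2_complete:
  assumes F: "\<And>n. F n \<in> l2_space"
    and Cauchy: "\<And>\<epsilon>. 0 < \<epsilon> \<Longrightarrow> \<exists>N. \<forall>m\<ge>N. \<forall>n\<ge>N. l2_norm (\<lambda>x. F m x - F n x) < \<epsilon>"
  shows "\<exists>g\<in>l2_space. (\<lambda>n. l2_norm (\<lambda>x. F n x - g x)) \<longlonglongrightarrow> 0"
proof -
  note [measurable] = F[THEN l2_measurable]
  have norm_nn: "(\<integral>\<^sup>+x. ennreal ((cmod (f x))\<^sup>2) \<partial>lborel) = ennreal ((l2_norm f)\<^sup>2)"
    if "f \<in> l2_space" for f :: "real ^ 'a \<Rightarrow> complex"
    unfolding l2_norm_power2 using l2_integrable_norm2[OF that]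
    by (intro nn_integral_eq_integral) auto
  obtain N where N: "\<And>k m n. m \<ge> N k \<Longrightarrow> n \<ge> N k \<Longrightarrow> l2_norm (\<lambda>x. F m x - F n x) < (1/2) ^ k"
    using Cauchy[of "(1/2) ^ _"] by (metis zero_less_divide_1_iff zero_less_numeral zero_less_power)
  \<comment> \<open>Summing \<open>N\<close> up to \<open>k\<close> puts both \<open>r k\<close> and
    \<open>r (Suc k)\<close> above \<open>N k\<close>; the summand \<open>k\<close> gives
    \<open>k \<le> r k\<close>, which the Fatou estimate uses.\<close>
  define r where "r k = k + (\<Sum>j\<le>k. N j)" for k
  have rN: "r k \<ge> N k" for k unfolding r_def by (intro trans_le_add2 member_le_sum) auto
  have rN': "r (Suc k) \<ge> N k" for k
    using rN[of k] by (simp add: r_def)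
  define D where "D k x = cmod (F (r (Suc k)) x - F (r k) x)" for k x
  have [measurable]: "D k \<in> borel_measurable borel" for k unfolding D_def by measurable
  have "(\<integral>\<^sup>+x. (\<Sum>k. ennreal (2 ^ k * (D k x)\<^sup>2)) \<partial>lborel) =
      (\<Sum>k. \<integral>\<^sup>+x. ennreal (2 ^ k * (D k x)\<^sup>2) \<partial>lborel)"
    by (rule nn_integral_suminf) measurable
  also have "\<dots> \<le> (\<Sum>k. ennreal ((1/2) ^ k))"
  proof (rule suminf_le)
    fix k
    have "(\<integral>\<^sup>+x. ennreal (2 ^ k * (D k x)\<^sup>2) \<partial>lborel) =
        ennreal (2 ^ k) * ennreal ((l2_norm (\<lambda>x. F (r (Suc k)) x - F (r k) x))\<^sup>2)"
      unfolding D_def by (subst norm_nn[symmetric]) (simp_all add: F ennreal_mult' nn_integral_cmult)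
    also have "\<dots> \<le> ennreal (2 ^ k * ((1/2) ^ k)\<^sup>2)"
      using N[OF rN' rN, of k]
      by (subst ennreal_mult'[symmetric]) (auto intro!: ennreal_leI mult_left_mono power_mono)
    also have "2 ^ k * ((1/2) ^ k)\<^sup>2 = ((1/2) ^ k :: real)"
      by (simp add: power2_eq_square field_simps)
    finally show "(\<integral>\<^sup>+x. ennreal (2 ^ k * (D k x)\<^sup>2) \<partial>lborel) \<le> ennreal ((1/2) ^ k)" .
  qed auto
  also have "\<dots> = ennreal (\<Sum>k. (1/2) ^ k)"
    by (rule suminf_ennreal2) (auto intro: summable_geometric)
  finally have "(\<integral>\<^sup>+x. (\<Sum>k. ennreal (2 ^ k * (D k x)\<^sup>2)) \<partial>lborel) \<noteq> \<infinity>"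
    by (auto simp: top_unique)
  then have "AE x in lborel. (\<Sum>k. ennreal (2 ^ k * (D k x)\<^sup>2)) \<noteq> \<infinity>"
    by (rule nn_integral_PInf_AE[rotated]) measurable
  then have conv: "AE x in lborel. convergent (\<lambda>k. F (r k) x)"
  proof eventually_elim
    case (elim x)
    have "summable (\<lambda>k. 2 ^ k * (D k x)\<^sup>2)"
      using elim by (intro summable_suminf_not_top) auto
    then have "Bseq (\<lambda>k. 2 ^ k * (D k x)\<^sup>2)"
      by (rule summable_imp_Bseq)
    then obtain B where "B > 0" and B': "\<And>k. norm (2 ^ k * (D k x)\<^sup>2) \<le> B"
      by (rule BseqE) blast
    have B: "2 ^ k * (D k x)\<^sup>2 \<le> B" for k
      using B'[of k] by (rule order_trans[rotated]) simp
    \<comment> \<open>Mere boundedness of the weighted terms is enough here: it dominates the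
      increments by a geometric sequence of ratio \<open>1 / sqrt 2\<close>.\<close>
    have "norm (F (r (Suc k)) x - F (r k) x) \<le> sqrt B * (1 / sqrt 2) ^ k" for k
    proof (rule power2_le_imp_le)
      have "(D k x)\<^sup>2 \<le> B * (1 / 2) ^ k"
        using B[of k] by (simp add: field_simps)
      then show "(norm (F (r (Suc k)) x - F (r k) x))\<^sup>2 \<le> (sqrt B * (1 / sqrt 2) ^ k)\<^sup>2"
        using \<open>B > 0\<close> by (simp add: D_def power_mult_distrib power_divide power_mult[symmetric] mult.commute[of k])
          (simp add: power_mult)
    qed (use \<open>B > 0\<close> in auto)
    moreover have "summable (\<lambda>k. sqrt B * (1 / sqrt 2) ^ k)"
      by (intro summable_mult summable_geometric) auto
    ultimately have "summable (\<lambda>k. F (r (Suc k)) x - F (r k) x)"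
      by (rule summable_comparison_test'[rotated])
    then have "convergent (\<lambda>n. \<Sum>k<n. F (r (Suc k)) x - F (r k) x)"
      by (simp add: summable_iff_convergent)
    then have "convergent (\<lambda>n. F (r n) x - F (r 0) x)"
      unfolding sum_lessThan_telescope[of "\<lambda>k. F (r k) x"] .
    then show ?case
      by (simp only: convergent_diff_const_right_iff)
  qed
  define g where "g x = lim (\<lambda>k. F (r k) x)" for x
  have [measurable]: "g \<in> borel_measurable borel"
    unfolding g_def by (rule borel_measurable_lim_metric) measurable
  have r_ge: "k \<le> r k" for k by (simp add: r_def)
  have lim: "AE x in lborel. (\<lambda>k. F (r k) x) \<longlonglongrightarrow> g x"
    using conv by eventually_elim (simp only: g_def convergent_LIMSEQ_iff)
  \<comment> \<open>Fatou's lemma, with \<open>n\<close> fixed and \<open>k\<close> tending to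
    infinity, turns the Cauchy bound into a bound on the distance to \<open>g\<close>. It is put as
    a nonnegative integral since square integrability of \<open>F n - g\<close> is only deduced from
    it.\<close>
  have close: "(\<integral>\<^sup>+x. ennreal ((cmod (F n x - g x))\<^sup>2) \<partial>lborel) \<le> ennreal (\<epsilon>\<^sup>2)"
    if N: "\<forall>m\<ge>N. \<forall>n\<ge>N. l2_norm (\<lambda>x. F m x - F n x) < \<epsilon>" and n: "n \<ge> N" for n N \<epsilon>
  proof -
    have "(\<integral>\<^sup>+x. ennreal ((cmod (F n x - g x))\<^sup>2) \<partial>lborel) =
        (\<integral>\<^sup>+x. liminf (\<lambda>k. ennreal ((cmod (F n x - F (r k) x))\<^sup>2)) \<partial>lborel)"
    proof (rule nn_integral_cong_AE)
      show "AE x in lborel. ennreal ((cmod (F n x - g x))\<^sup>2) =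
          liminf (\<lambda>k. ennreal ((cmod (F n x - F (r k) x))\<^sup>2))"
        using lim
      proof eventually_elim
        case (elim x)
        then have "(\<lambda>k. ennreal ((cmod (F n x - F (r k) x))\<^sup>2)) \<longlonglongrightarrow> ennreal ((cmod (F n x - g x))\<^sup>2)"
          by (intro tendsto_ennrealI tendsto_intros)
        then show ?case by (intro lim_imp_Liminf[symmetric]) simp_all
      qed
    qed
    also have "\<dots> \<le> liminf (\<lambda>k. \<integral>\<^sup>+x. ennreal ((cmod (F n x - F (r k) x))\<^sup>2) \<partial>lborel)"
      by (rule nn_integral_liminf) measurable
    also have "\<dots> \<le> limsup (\<lambda>k. \<integral>\<^sup>+x. ennreal ((cmod (F n x - F (r k) x))\<^sup>2) \<partial>lborel)"
      by (rule Liminf_le_Limsup) simp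
    also have "\<dots> \<le> ennreal (\<epsilon>\<^sup>2)"
    proof (rule Limsup_bounded)
      show "\<forall>\<^sub>F k in sequentially. (\<integral>\<^sup>+x. ennreal ((cmod (F n x - F (r k) x))\<^sup>2) \<partial>lborel) \<le> ennreal (\<epsilon>\<^sup>2)"
        using eventually_ge_at_top[of N]
      proof eventually_elim
        case (elim k)
        then have "r k \<ge> N" using r_ge[of k] by linarith
        then have "l2_norm (\<lambda>x. F n x - F (r k) x) < \<epsilon>"
          using N n by blast
        then show ?case
          by (subst norm_nn) (auto simp: F intro!: ennreal_leI power_mono)
      qed
    qed
    finally show ?thesis .
  qed
  have diff: "(\<lambda>x. F n x - g x) \<in> l2_space \<and> l2_norm (\<lambda>x. F n x - g x) \<le> \<epsilon>"
    if N: "\<forall>m\<ge>N. \<forall>n\<ge>N. l2_norm (\<lambda>x. F m x - F n x) < \<epsilon>" and n: "n \<ge> N" and \<epsilon>: "0 < \<epsilon>" for n N \<epsilon>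
  proof
    show *: "(\<lambda>x. F n x - g x) \<in> l2_space"
    proof (rule l2_spaceI)
      show "integrable lborel (\<lambda>x. (cmod (F n x - g x))\<^sup>2)"
        by (rule integrableI_bounded) (use close[OF N n] in \<open>auto simp: le_less_trans\<close>)
    qed measurable
    have "ennreal ((l2_norm (\<lambda>x. F n x - g x))\<^sup>2) \<le> ennreal (\<epsilon>\<^sup>2)"
      using close[OF N n] norm_nn[OF *] by simp
    then show "l2_norm (\<lambda>x. F n x - g x) \<le> \<epsilon>"
      using \<epsilon> by (simp add: power2_le_iff_abs_le)
  qed
  show ?thesis
  proof (rule bexI)
    obtain N where "\<forall>m\<ge>N. \<forall>n\<ge>N. l2_norm (\<lambda>x. F m x - F n x) < 1"
      using Cauchy[of 1] by auto
    then have "(\<lambda>x. F N x - g x) \<in> l2_space"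
      using diff[of N 1 N] by simp
    from l2_diff[OF F[of N] this] have "(\<lambda>x. F N x - (F N x - g x)) \<in> l2_space" .
    then show "g \<in> l2_space" by simp
    show "(\<lambda>n. l2_norm (\<lambda>x. F n x - g x)) \<longlonglongrightarrow> 0"
    proof (rule LIMSEQ_I)
      fix \<epsilon> :: real assume "0 < \<epsilon>"
      then obtain N where N: "\<forall>m\<ge>N. \<forall>n\<ge>N. l2_norm (\<lambda>x. F m x - F n x) < \<epsilon> / 2"
        using Cauchy[OF half_gt_zero] by blast
      have "norm (l2_norm (\<lambda>x. F n x - g x) - 0) < \<epsilon>" if "n \<ge> N" for n
        using conjunct2[OF diff[OF N that half_gt_zero[OF \<open>0 < \<epsilon>\<close>]]] \<open>0 < \<epsilon>\<close> by simp
      then show "\<exists>N. \<forall>n\<ge>N. norm (l2_norm (\<lambda>x. F n x - g x) - 0) < \<epsilon>"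
        by blast
    qed
  qed
qed

section \<open>Orthonormal bases\<close>

text \<open>The index set is free so that one notion serves three uses: a set of functions indexed
  by itself (for Zorn's lemma), a sequence over \<open>UNIV\<close>, and its finite segments (for
  Bessel's inequality).\<close>

definition l2_orthonormal :: "'i set \<Rightarrow> ('i \<Rightarrow> real ^ 'd::finite \<Rightarrow> complex) \<Rightarrow> bool" where
  "l2_orthonormal I e \<longleftrightarrow> (\<forall>i\<in>I. e i \<in> l2_space) \<and>
     (\<forall>i\<in>I. \<forall>j\<in>I. l2_inner (e i) (e j) = (if i = j then 1 else 0))"

lemma l2_orthonormal_norm: "l2_orthonormal I e \<Longrightarrow> i \<in> I \<Longrightarrow> l2_norm (e i) = 1"
proof -
  assume "l2_orthonormal I e" "i \<in> I"
  then have "l2_inner (e i) (e i) = 1"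
    by (simp add: l2_orthonormal_def)
  then have "(l2_norm (e i))\<^sup>2 = 1"
    by (simp add: Re_l2_inner_self[symmetric])
  then show ?thesis
    by (simp add: power2_eq_1_iff) (use l2_norm_nonneg[of "e i"] in linarith)
qed

lemma l2_norm_sum_power2:
  assumes "l2_orthonormal I e" "finite I"
  shows "(l2_norm (\<lambda>x. \<Sum>i\<in>I. c i * e i x))\<^sup>2 = (\<Sum>i\<in>I. (cmod (c i))\<^sup>2)"
proof -
  have e: "\<And>i. i \<in> I \<Longrightarrow> e i \<in> l2_space"
    and ee: "\<And>i j. i \<in> I \<Longrightarrow> j \<in> I \<Longrightarrow> l2_inner (e i) (e j) = (if i = j then 1 else 0)"
    using assms by (auto simp: l2_orthonormal_def)
  have "l2_inner (\<lambda>x. \<Sum>i\<in>I. c i * e i x) (\<lambda>x. \<Sum>i\<in>I. c i * e i x) =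
      (\<Sum>i\<in>I. \<Sum>j\<in>I. c i * (cnj (c j) * (if i = j then 1 else 0)))"
    using e by (simp add: l2_inner_simps ee sum_distrib_left cong: sum.cong)
  also have "\<dots> = complex_of_real (\<Sum>i\<in>I. (cmod (c i))\<^sup>2)"
    using assms(2) by (simp add: complex_norm_square if_distrib[of "(*) _"] cong: if_cong del: of_real_power)
  finally show ?thesis
    unfolding l2_inner_self of_real_eq_iff .
qed

text \<open>The inner product of \<open>f\<close> with its projection equals the squared norm of the
  projection, so expanding the square leaves a plain difference. Bessel's inequality and, for a
  finite total set, Parseval's identity are read off from it.\<close>

lemma l2_norm_minus_projection:
  assumes on: "l2_orthonormal I e" and "finite I" and f: "f \<in> l2_space"
  shows "(l2_norm (\<lambda>x. f x - (\<Sum>i\<in>I. l2_inner f (e i) * e i x)))\<^sup>2 =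
    (l2_norm f)\<^sup>2 - (\<Sum>i\<in>I. (cmod (l2_inner f (e i)))\<^sup>2)"
proof -
  have e: "\<And>i. i \<in> I \<Longrightarrow> e i \<in> l2_space"
    using on by (auto simp: l2_orthonormal_def)
  have "l2_inner f (\<lambda>x. \<Sum>i\<in>I. l2_inner f (e i) * e i x) =
      complex_of_real (\<Sum>i\<in>I. (cmod (l2_inner f (e i)))\<^sup>2)"
    using e f by (simp add: l2_inner_simps complex_norm_square mult.commute[of "cnj _"] del: of_real_power)
  then show ?thesis
    using l2_norm_diff_scale_power2[OF f, of "\<lambda>x. \<Sum>i\<in>I. l2_inner f (e i) * e i x" 1] e
      l2_norm_sum_power2[OF on assms(2), of "\<lambda>i. l2_inner f (e i)"]
    by (simp del: of_real_sum)
qed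

lemma l2_Bessel:
  assumes "l2_orthonormal I e" "finite I" "f \<in> l2_space"
  shows "(\<Sum>i\<in>I. (cmod (l2_inner f (e i)))\<^sup>2) \<le> (l2_norm f)\<^sup>2"
  using l2_norm_minus_projection[OF assms]
    zero_le_power2[of "l2_norm (\<lambda>x. f x - (\<Sum>i\<in>I. l2_inner f (e i) * e i x))"]
  by linarith

section \<open>Separability and infinite dimension\<close>

lemma l2_indicator [simp]:
  assumes "A \<in> sets borel" "emeasure lborel A < \<infinity>"
  shows "indicator A \<in> l2_space"
proof (rule l2_spaceI)
  show "indicator A \<in> borel_measurable borel" using assms by simp
  have "(\<lambda>x. (cmod (indicator A x))\<^sup>2) = indicat_real A"
    by (auto simp: indicator_def)
  then show "integrable lborel (\<lambda>x. (cmod (indicator A x))\<^sup>2)" using assms by simp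
qed

text \<open>The generator consists of the finite intersections of a countable basis: countability
  and stability come for free, and the empty intersection contributes \<open>UNIV\<close>. This is
  the form that a Dynkin argument with a countable test family requires.\<close>

lemma countable_Int_stable_generator_borel:
  obtains E :: "'a :: second_countable_topology set set"
  where "countable E" "Int_stable E" "UNIV \<in> E" "\<And>A. A \<in> E \<Longrightarrow> open A"
    "sets borel = sigma_sets UNIV E"
proof -
  obtain B :: "'a set set" where B: "countable B" "topological_basis B"
    using ex_countable_basis by blast
  define E where "E = Inter ` {F. finite F \<and> F \<subseteq> B}"
  have op: "open A" if "A \<in> E" for A
    using that topological_basis_open[OF B(2)] by (auto simp: E_def intro!: open_Inter)
  have BE: "B \<subseteq> E"
  proof
    fix b assume "b \<in> B"
    then show "b \<in> E" unfolding E_def by (intro image_eqI[of _ _ "{b}"]) auto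
  qed
  have "sets borel = sigma_sets UNIV {S :: 'a set. open S}"
    by (simp add: borel_def)
  also have "\<dots> = sigma_sets UNIV E"
  proof (rule sigma_sets_eqI)
    fix a :: "'a set" assume "a \<in> {S. open S}"
    then obtain B' where B': "B' \<subseteq> B" "a = \<Union>B'"
      using B(2) by (auto simp: topological_basis_def)
    have "\<Union>B' \<in> sigma_sets UNIV E"
      using B' BE countable_subset[OF B'(1) B(1)] by (intro sigma_sets_UNION) auto
    then show "a \<in> sigma_sets UNIV E" using B' by simp
  qed (auto dest: op)
  finally have "sets borel = sigma_sets UNIV E" .
  moreover have "countable E"
    unfolding E_def by (intro countable_image countable_Collect_finite_subset B)
  moreover have "UNIV \<in> E"
    unfolding E_def by (intro image_eqI[of _ _ "{}"]) auto
  moreover have "Int_stable E"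
  proof (rule Int_stableI)
    fix a b assume "a \<in> E" "b \<in> E"
    then obtain F G where "finite F" "F \<subseteq> B" "a = \<Inter>F" "finite G" "G \<subseteq> B" "b = \<Inter>G"
      by (auto simp: E_def)
    then show "a \<inter> b \<in> E"
      unfolding E_def by (intro image_eqI[of _ _ "F \<union> G"]) auto
  qed
  ultimately show ?thesis using op by (intro that[of E]) simp_all
qed

text \<open>Dynkin's argument: the sets over which \<open>h\<close> integrates to zero are closed
  under complements, because \<open>UNIV\<close> is one of them, and under countable disjoint
  unions. They therefore comprise all Borel sets, which forces the density \<open>h\<close> to
  vanish.\<close>

lemma integral_zero_on_generator_imp_AE_zero:
  fixes h :: "'a::euclidean_space \<Rightarrow> complex"
  assumes h: "integrable lborel h"
    and E: "Int_stable E" "UNIV \<in> E" "sets borel = sigma_sets UNIV E"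
    and zero: "\<And>A. A \<in> E \<Longrightarrow> (LINT x:A|lborel. h x) = 0"
  shows "AE x in lborel. h x = 0"
proof (rule sigma_finite_measure.density_zero[OF sigma_finite_lborel h])
  have sub: "E \<subseteq> Pow UNIV" by simp
  have si: "set_integrable lborel A h" if "A \<in> sets borel" for A
    using h that unfolding set_integrable_def by (intro integrable_mult_indicator) auto
  fix A assume "A \<in> sets (lborel :: 'a measure)"
  then have "A \<in> sigma_sets UNIV E"
    unfolding sets_lborel E(3) .
  then show "(LINT x:A|lborel. h x) = 0"
  proof (induction rule: sigma_sets_induct_disjoint[OF E(1) sub, consumes 1, case_names basic empty compl union])
    case (basic A) then show ?case by (rule zero)
  next
    case empty show ?case by (simp add: set_lebesgue_integral_def)
  next
    case (compl A)
    have A: "A \<in> sets borel" using compl(1) unfolding E(3) .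
    have "(LINT x:UNIV|lborel. h x) = (LINT x:(A \<union> (UNIV - A))|lborel. h x)" by simp
    also have "\<dots> = (LINT x:A|lborel. h x) + (LINT x:(UNIV - A)|lborel. h x)"
      using A by (intro set_integral_Un si) auto
    finally show ?case using compl(2) zero[OF E(2)] by simp
  next
    case (union A)
    then have "\<And>i. A i \<in> sets borel" unfolding E(3) by blast
    then have "(LINT x:(\<Union>i. A i)|lborel. h x) = (\<Sum>i. (LINT x:(A i)|lborel. h x))"
      using union(1) by (intro lebesgue_integral_countable_add si) (auto simp: disjoint_family_on_def)
    then show ?case using union(3) by simp
  qed
qed

text \<open>A square-integrable function need not be integrable, but its restriction to a ball is.
  Cutting the generator by balls of integer radius thus reduces the claim to the integrable case on
  each ball, and it also gives the test sets finite measure.\<close>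

lemma l2_countable_total_family:
  obtains E :: "(real ^ 'd::finite) set set"
  where "countable E" "\<And>A. A \<in> E \<Longrightarrow> indicator A \<in> l2_space"
    "\<And>f. f \<in> l2_space \<Longrightarrow> (\<And>A. A \<in> E \<Longrightarrow> l2_inner f (indicator A) = 0) \<Longrightarrow> l2_eq f (\<lambda>x. 0)"
proof -
  obtain G :: "(real ^ 'd) set set" where G: "countable G" "Int_stable G" "UNIV \<in> G"
    "\<And>A. A \<in> G \<Longrightarrow> open A" "sets borel = sigma_sets UNIV G"
    by (rule countable_Int_stable_generator_borel) blast
  define E where "E = (\<lambda>(A, n). A \<inter> ball 0 (real n)) ` (G \<times> (UNIV :: nat set))"
  have "countable E" unfolding E_def using G(1) by simp
  moreover have "indicator A \<in> l2_space" if AE: "A \<in> E" for A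
  proof (rule l2_indicator)
    obtain X n where A: "A = X \<inter> ball 0 (real n)" and X: "open X"
      using AE G(4) by (auto simp: E_def)
    show "A \<in> sets borel" unfolding A using X by simp
    have "emeasure lborel A \<le> emeasure lborel (ball (0 :: real ^ 'd) (real n))"
      unfolding A by (intro emeasure_mono) auto
    also have "\<dots> < \<infinity>" using emeasure_lborel_ball_finite[of 0 "real n"] by simp
    finally show "emeasure lborel A < \<infinity>" .
  qed
  moreover have "l2_eq f (\<lambda>x. 0)"
    if f: "f \<in> l2_space" and zero: "\<And>A. A \<in> E \<Longrightarrow> l2_inner f (indicator A) = 0" for f
  proof -
    have "AE x in lborel. indicator (ball 0 (real n)) x * f x = 0" for n
    proof (rule integral_zero_on_generator_imp_AE_zero[OF _ G(2,3,5)])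
      have "emeasure lborel (ball (0 :: real ^ 'd) (real n)) < \<infinity>"
        using emeasure_lborel_ball_finite[of 0 "real n"] by simp
      then show "integrable lborel (\<lambda>x. indicator (ball 0 (real n)) x * f x)"
        using f by (intro l2_integrable_mult) auto
      fix A assume "A \<in> G"
      then have "A \<inter> ball 0 (real n) \<in> E" by (auto simp: E_def)
      from zero[OF this]
      show "(LINT x:A|lborel. indicator (ball 0 (real n)) x * f x) = 0"
        unfolding l2_inner_def set_lebesgue_integral_def
        by (rule trans[rotated]) (auto intro!: Bochner_Integration.integral_cong simp: indicator_def)
    qed
    then have "AE x in lborel. \<forall>n. indicator (ball 0 (real n)) x * f x = 0"
      unfolding AE_all_countable by blast
    then show ?thesis
      unfolding l2_eq_def
    proof eventually_elim
      case (elim x)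
      obtain n where "norm x < real n" using reals_Archimedean2 by blast
      then show ?case using elim[rule_format, of n] by simp
    qed
  qed
  ultimately show ?thesis by (intro that[of E]) simp_all
qed

text \<open>Totality is expressed by a trivial orthogonal complement because maximality produces it
  in this shape. For orthonormal sequences it is equivalent to the density demanded by
  \<open>l2_orthonormal_basis\<close>; \<open>l2_orthonormal_basisI\<close> and
  \<open>l2_orthonormal_basisD\<close> give the two directions.\<close>

definition l2_total :: "(real ^ 'd::finite \<Rightarrow> complex) set \<Rightarrow> bool" where
  "l2_total B \<longleftrightarrow> (\<forall>f\<in>l2_orth B. l2_eq f (\<lambda>x. 0))"

text \<open>By Bessel's inequality the coefficients of one indicator along \<open>B\<close> are
  summable, so it is orthogonal to all but countably many members. Every member is nonzero and
  therefore fails to be orthogonal to some indicator of the countable total family.\<close>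

lemma l2_orthonormal_countable:
  assumes B: "l2_orthonormal B (\<lambda>b. b)"
  shows "countable (B :: (real ^ 'd::finite \<Rightarrow> complex) set)"
proof -
  obtain E :: "(real ^ 'd) set set" where E: "countable E" "\<And>A. A \<in> E \<Longrightarrow> indicator A \<in> l2_space"
    "\<And>f. f \<in> l2_space \<Longrightarrow> (\<And>A. A \<in> E \<Longrightarrow> l2_inner f (indicator A) = 0) \<Longrightarrow> l2_eq f (\<lambda>x. 0)"
    using l2_countable_total_family by blast
  have "B \<subseteq> (\<Union>A\<in>E. {b\<in>B. (cmod (l2_inner (indicator A) b))\<^sup>2 \<noteq> 0})"
  proof
    fix b assume b: "b \<in> B"
    then have "b \<in> l2_space" "l2_norm b = 1"
      using B l2_orthonormal_norm[OF B b] by (auto simp: l2_orthonormal_def)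
    then have "\<not> l2_eq b (\<lambda>x. 0)" using l2_norm_eq_0_iff by force
    then obtain A where A: "A \<in> E" "l2_inner b (indicator A) \<noteq> 0"
      using E(3) \<open>b \<in> l2_space\<close> by blast
    then have "l2_inner (indicator A) b \<noteq> 0"
      unfolding l2_inner_commute[of "indicator A" b] by simp
    with A(1) show "b \<in> (\<Union>A\<in>E. {b\<in>B. (cmod (l2_inner (indicator A) b))\<^sup>2 \<noteq> 0})"
      using b by auto
  qed
  moreover have "countable {b\<in>B. (cmod (l2_inner (indicator A) b))\<^sup>2 \<noteq> 0}" if "A \<in> E" for A
  proof (rule summable_countable_real, rule nonneg_bounded_partial_sums_imp_summable_on)
    show "\<forall>\<^sub>F X in finite_subsets_at_top B.
        (\<Sum>b\<in>X. (cmod (l2_inner (indicator A) b))\<^sup>2) \<le> (l2_norm (indicator A))\<^sup>2"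
    proof (rule eventually_finite_subsets_at_top_weakI)
      fix X assume X: "finite X" "X \<subseteq> B"
      then have "l2_orthonormal X (\<lambda>b. b)"
        using B unfolding l2_orthonormal_def by blast
      from l2_Bessel[OF this X(1) E(2)[OF that]]
      show "(\<Sum>b\<in>X. (cmod (l2_inner (indicator A) b))\<^sup>2) \<le> (l2_norm (indicator A))\<^sup>2" .
    qed
  qed simp
  ultimately show ?thesis
    using E(1) by (meson countable_UN countable_subset)
qed

text \<open>Indicators of open unit cubes lined up along the diagonal: the cubes are disjoint and
  have measure one, so no normalisation arises.\<close>

lemma l2_infinite_orthonormal:
  obtains g :: "nat \<Rightarrow> real ^ 'd::finite \<Rightarrow> complex" where "l2_orthonormal UNIV g"
proof
  define Q :: "nat \<Rightarrow> (real ^ 'd) set" where "Q j = box (real j *\<^sub>R One) ((real j + 1) *\<^sub>R One)" for j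
  have disj: "Q i \<inter> Q j = {}" if "i \<noteq> j" for i j
  proof -
    have "False" if x: "x \<in> Q i" "x \<in> Q j" for x
    proof -
      obtain b :: "real ^ 'd" where b: "b \<in> Basis" using nonempty_Basis by blast
      have "real i < x \<bullet> b" "x \<bullet> b < real i + 1" "real j < x \<bullet> b" "x \<bullet> b < real j + 1"
        using x b unfolding Q_def mem_box by (auto dest!: bspec[OF _ b])
      then have "real i < real j + 1" "real j < real i + 1" by linarith+
      then show False using \<open>i \<noteq> j\<close> by linarith
    qed
    then show ?thesis by blast
  qed
  have meas: "measure lborel (Q j) = 1" for j
    unfolding Q_def by (subst measure_lborel_box) (auto simp: inner_simps)
  have Q: "Q j \<in> sets borel" "emeasure lborel (Q j) < \<infinity>" for j
    unfolding Q_def using emeasure_lborel_box_finite by auto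
  have "l2_inner (indicator (Q i)) (indicator (Q j)) = complex_of_real (measure lborel (Q i \<inter> Q j))" for i j
  proof -
    have "l2_inner (indicator (Q i)) (indicator (Q j)) =
        (LINT x|lborel. complex_of_real (indicator (Q i \<inter> Q j) x))"
      unfolding l2_inner_def by (intro Bochner_Integration.integral_cong) (auto simp: indicator_def)
    also have "\<dots> = complex_of_real (LINT x|lborel. indicator (Q i \<inter> Q j) x)"
      by (rule integral_complex_of_real)
    finally show ?thesis using Q by simp
  qed
  then show "l2_orthonormal UNIV (\<lambda>j. indicator (Q j))"
    using meas disj Q by (auto simp: l2_orthonormal_def)
qed

text \<open>If \<open>B\<close> had \<open>n\<close> elements, adding up Parseval's identity for \<open>n + 1\<close> orthonormal functions and
  applying Bessel's inequality to each element of \<open>B\<close> would give \<open>n + 1 \<le> n\<close>.\<close>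

lemma l2_total_orthonormal_infinite:
  assumes B: "l2_orthonormal B (\<lambda>b. b)" and total: "l2_total B"
  shows "infinite B"
proof
  assume fin: "finite B"
  obtain g :: "nat \<Rightarrow> real ^ 'a \<Rightarrow> complex" where g: "l2_orthonormal UNIV g"
    using l2_infinite_orthonormal by blast
  define n where "n = card B"
  have gV: "g j \<in> l2_space" for j using g by (auto simp: l2_orthonormal_def)
  have BV: "\<And>b. b \<in> B \<Longrightarrow> b \<in> l2_space"
    and BB: "\<And>b c. b \<in> B \<Longrightarrow> c \<in> B \<Longrightarrow> l2_inner b c = (if b = c then 1 else 0)"
    using B unfolding l2_orthonormal_def by blast+
  have Parseval: "(\<Sum>b\<in>B. (cmod (l2_inner (g j) b))\<^sup>2) = 1" for j
  proof -
    define r where "r = (\<lambda>x. g j x - (\<Sum>b\<in>B. l2_inner (g j) b * b x))"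
    have "r \<in> l2_space" unfolding r_def using gV BV by simp
    moreover have "l2_inner r c = 0" if "c \<in> B" for c
    proof -
      have "l2_inner r c = l2_inner (g j) c - (\<Sum>b\<in>B. l2_inner (g j) b * (if b = c then 1 else 0))"
        unfolding r_def using gV BV that by (simp add: l2_inner_simps BB cong: sum.cong)
      also have "\<dots> = 0"
        using fin that by (simp add: if_distrib[of "(*) _"] cong: if_cong)
      finally show ?thesis .
    qed
    ultimately have "l2_eq r (\<lambda>x. 0)"
      using total by (auto simp: l2_total_def l2_orth_def)
    then have "l2_norm r = 0" using l2_norm_eq_0_iff[OF \<open>r \<in> l2_space\<close>] by simp
    moreover have "l2_norm (g j) = 1" using l2_orthonormal_norm[OF g] by simp
    ultimately show ?thesis
      using l2_norm_minus_projection[OF B fin gV[of j]] unfolding r_def by simp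
  qed
  have "real (Suc n) = (\<Sum>j\<le>n. \<Sum>b\<in>B. (cmod (l2_inner (g j) b))\<^sup>2)"
    unfolding Parseval by simp
  also have "\<dots> = (\<Sum>b\<in>B. \<Sum>j\<le>n. (cmod (l2_inner b (g j)))\<^sup>2)"
    by (subst sum.swap, subst l2_inner_commute) simp
  also have "\<dots> \<le> (\<Sum>b\<in>B. (l2_norm b)\<^sup>2)"
  proof (rule sum_mono)
    fix b assume "b \<in> B"
    have "l2_orthonormal {..n} g" using g by (auto simp: l2_orthonormal_def)
    then show "(\<Sum>j\<le>n. (cmod (l2_inner b (g j)))\<^sup>2) \<le> (l2_norm b)\<^sup>2"
      by (rule l2_Bessel) (use BV \<open>b \<in> B\<close> in auto)
  qed
  also have "\<dots> = (\<Sum>b\<in>B. 1)"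
    by (rule sum.cong) (use l2_orthonormal_norm[OF B] in auto)
  also have "\<dots> = real n" by (simp add: n_def)
  finally show False by simp
qed

section \<open>Expansion in a total orthonormal sequence\<close>

lemma l2_orthonormal_coeff:
  assumes "l2_orthonormal (UNIV :: nat set) e"
  shows "l2_inner (\<lambda>x. \<Sum>i<N. c i * e i x) (e j) = (if j < N then c j else 0)"
proof -
  have e: "\<And>i. e i \<in> l2_space" and ee: "\<And>i j. l2_inner (e i) (e j) = (if i = j then 1 else 0)"
    using assms unfolding l2_orthonormal_def by blast+
  have "l2_inner (\<lambda>x. \<Sum>i<N. c i * e i x) (e j) = (\<Sum>i<N. c i * (if i = j then 1 else 0))"
    using e by (simp add: l2_inner_simps ee cong: sum.cong)
  then show ?thesis by (simp add: if_distrib[of "(*) _"] cong: if_cong)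
qed

lemma l2_summable_coeffs:
  assumes e: "l2_orthonormal (UNIV :: nat set) e" and f: "f \<in> l2_space"
  shows "summable (\<lambda>i. (cmod (l2_inner f (e i)))\<^sup>2)"
proof (rule summableI_nonneg_bounded)
  fix n
  have "l2_orthonormal {..<n} e" using e by (auto simp: l2_orthonormal_def)
  from l2_Bessel[OF this _ f] show "(\<Sum>i<n. (cmod (l2_inner f (e i)))\<^sup>2) \<le> (l2_norm f)\<^sup>2" by simp
qed simp

text \<open>Squared distances of partial sums are differences of the partial sums of a convergent
  series, so completeness gives a limit \<open>g\<close>. It has the same coefficients as
  \<open>f\<close>, and totality makes the two equal almost everywhere.\<close>

lemma l2_expansion:
  assumes e: "l2_orthonormal (UNIV :: nat set) e" and total: "l2_total (range e)" and f: "f \<in> l2_space"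
  shows "(\<lambda>N. l2_norm (\<lambda>x. (\<Sum>i<N. l2_inner f (e i) * e i x) - f x)) \<longlonglongrightarrow> 0"
proof -
  define c where "c i = l2_inner f (e i)" for i
  define F where "F N = (\<lambda>x. \<Sum>i<N. c i * e i x)" for N
  define s where "s N = (\<Sum>i<N. (cmod (c i))\<^sup>2)" for N
  have eV: "e i \<in> l2_space" for i using e by (auto simp: l2_orthonormal_def)
  have FV: "F N \<in> l2_space" for N unfolding F_def using eV by simp
  have norm_le: "(l2_norm (\<lambda>x. F m x - F n x))\<^sup>2 = s m - s n" if "n \<le> m" for m n
  proof -
    have "(\<lambda>x. F m x - F n x) = (\<lambda>x. \<Sum>i\<in>{n..<m}. c i * e i x)"
    proof
      fix x show "F m x - F n x = (\<Sum>i\<in>{n..<m}. c i * e i x)"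
        unfolding F_def lessThan_atLeast0
        using sum_diff_nat_ivl[of 0 n m "\<lambda>i. c i * e i x"] that by simp
    qed
    moreover have "l2_orthonormal {n..<m} e" using e by (auto simp: l2_orthonormal_def)
    ultimately have "(l2_norm (\<lambda>x. F m x - F n x))\<^sup>2 = (\<Sum>i\<in>{n..<m}. (cmod (c i))\<^sup>2)"
      by (simp add: l2_norm_sum_power2)
    also have "\<dots> = s m - s n"
      unfolding s_def lessThan_atLeast0
      using sum_diff_nat_ivl[of 0 n m "\<lambda>i. (cmod (c i))\<^sup>2"] that by simp
    finally show ?thesis .
  qed
  have norm_eq: "(l2_norm (\<lambda>x. F m x - F n x))\<^sup>2 = \<bar>s m - s n\<bar>" for m n
  proof (cases "n \<le> m")
    case True
    from norm_le[OF this] show ?thesis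
      by (metis abs_of_nonneg zero_le_power2)
  next
    case False
    then have "(l2_norm (\<lambda>x. F n x - F m x))\<^sup>2 = s n - s m" by (intro norm_le) simp
    moreover have "0 \<le> (l2_norm (\<lambda>x. F n x - F m x))\<^sup>2" by simp
    ultimately show ?thesis
      unfolding l2_norm_minus_commute[of "F m" "F n"] by linarith
  qed
  have "Cauchy s"
    unfolding s_def using l2_summable_coeffs[OF e f]
    by (simp add: c_def summable_iff_convergent Cauchy_convergent_iff)
  have "\<exists>g\<in>l2_space. (\<lambda>n. l2_norm (\<lambda>x. F n x - g x)) \<longlonglongrightarrow> 0"
  proof (rule l2_complete[OF FV])
    fix \<epsilon> :: real assume "0 < \<epsilon>"
    then obtain N where N: "\<And>m n. m \<ge> N \<Longrightarrow> n \<ge> N \<Longrightarrow> \<bar>s m - s n\<bar> < \<epsilon>\<^sup>2"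
      using \<open>Cauchy s\<close> unfolding Cauchy_def dist_real_def by (meson zero_less_power)
    have "l2_norm (\<lambda>x. F m x - F n x) < \<epsilon>" if "m \<ge> N" "n \<ge> N" for m n
      by (rule power2_less_imp_less) (use N[OF that] \<open>0 < \<epsilon>\<close> in \<open>auto simp: norm_eq\<close>)
    then show "\<exists>N. \<forall>m\<ge>N. \<forall>n\<ge>N. l2_norm (\<lambda>x. F m x - F n x) < \<epsilon>" by blast
  qed
  then obtain g where g: "g \<in> l2_space" and lim: "(\<lambda>n. l2_norm (\<lambda>x. F n x - g x)) \<longlonglongrightarrow> 0"
    by blast
  have "l2_inner (\<lambda>x. f x - g x) (e j) = 0" for j
  proof -
    have "(\<lambda>n. l2_inner (F n) (e j)) \<longlonglongrightarrow> l2_inner g (e j)"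
      by (rule l2_inner_tendsto[OF FV g eV lim])
    moreover have "(\<lambda>n. l2_inner (F n) (e j)) \<longlonglongrightarrow> c j"
      unfolding F_def l2_orthonormal_coeff[OF e]
      by (rule tendsto_eventually) (auto simp: eventually_sequentially intro!: exI[of _ "Suc j"])
    ultimately have "l2_inner g (e j) = c j" by (rule LIMSEQ_unique)
    then show ?thesis using f g eV by (simp add: l2_inner_simps c_def)
  qed
  then have "l2_eq (\<lambda>x. f x - g x) (\<lambda>x. 0)"
    using total f g by (auto simp: l2_total_def l2_orth_def)
  then have "AE x in lborel. f x = g x" by (simp add: l2_eq_def)
  then have "l2_eq (\<lambda>x. F n x - f x) (\<lambda>x. F n x - g x)" for n
    unfolding l2_eq_def by eventually_elim simp
  then have "l2_norm (\<lambda>x. F n x - f x) = l2_norm (\<lambda>x. F n x - g x)" for n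
    by (intro l2_norm_cong l2_diff FV f g)
  then show ?thesis using lim unfolding F_def c_def by simp
qed

lemma l2_orthonormal_basisI:
  assumes e: "l2_orthonormal UNIV e" and total: "l2_total (range e)"
  shows "l2_orthonormal_basis e"
  unfolding l2_orthonormal_basis_def
proof (intro conjI ballI allI impI)
  fix f :: "real ^ 'a \<Rightarrow> complex" and \<epsilon> :: real assume f: "f \<in> l2_space" and "0 < \<epsilon>"
  from LIMSEQ_D[OF l2_expansion[OF e total f] \<open>0 < \<epsilon>\<close>]
  obtain N where "l2_norm (\<lambda>x. (\<Sum>i<N. l2_inner f (e i) * e i x) - f x) < \<epsilon>" by auto
  then show "\<exists>N c. l2_norm (\<lambda>x. f x - (\<Sum>i<N. c i * e i x)) < \<epsilon>"
    by (subst (asm) l2_norm_minus_commute) (intro exI)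
qed (use e in \<open>simp_all add: l2_orthonormal_def\<close>)

lemma l2_orthonormal_basisD:
  assumes "l2_orthonormal_basis e"
  shows "l2_orthonormal UNIV e" "l2_total (range e)"
proof -
  show e: "l2_orthonormal UNIV e"
    using assms unfolding l2_orthonormal_basis_def l2_orthonormal_def by blast
  then have eV: "e i \<in> l2_space" for i by (auto simp: l2_orthonormal_def)
  show "l2_total (range e)"
    unfolding l2_total_def
  proof
    fix f assume "f \<in> l2_orth (range e)"
    then have f: "f \<in> l2_space" and fe: "\<And>i. l2_inner f (e i) = 0"
      by (auto simp: l2_orth_def)
    have "l2_norm f \<le> \<epsilon>" if pos: "0 < \<epsilon>" for \<epsilon>
    proof -
      obtain N c where less: "l2_norm (\<lambda>x. f x - (\<Sum>i<N. c i * e i x)) < \<epsilon>"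
        using assms f pos unfolding l2_orthonormal_basis_def by meson
      \<comment> \<open>A function orthogonal to all \<open>e i\<close> is orthogonal to every
        approximant, so subtracting one cannot decrease its norm; density then makes the norm
        arbitrarily small.\<close>
      have "l2_inner f (\<lambda>x. \<Sum>i<N. c i * e i x) = 0"
        using f eV by (simp add: l2_inner_simps fe)
      then have "(l2_norm (\<lambda>x. f x - (\<Sum>i<N. c i * e i x)))\<^sup>2 =
          (l2_norm f)\<^sup>2 + (l2_norm (\<lambda>x. \<Sum>i<N. c i * e i x))\<^sup>2"
        using l2_norm_diff_scale_power2[OF f, of "\<lambda>x. \<Sum>i<N. c i * e i x" 1] eV by simp
      then have "(l2_norm f)\<^sup>2 \<le> (l2_norm (\<lambda>x. f x - (\<Sum>i<N. c i * e i x)))\<^sup>2" by simp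
      then have "l2_norm f \<le> l2_norm (\<lambda>x. f x - (\<Sum>i<N. c i * e i x))"
        by (rule power2_le_imp_le) simp
      with less show ?thesis by simp
    qed
    then have "l2_norm f \<le> 0" by (rule field_le_epsilon[of _ 0, simplified])
    then show "l2_eq f (\<lambda>x. 0)"
      using l2_norm_eq_0_iff[OF f] l2_norm_nonneg[of f] by simp
  qed
qed

lemma l2_Parseval:
  assumes "l2_orthonormal_basis e" "f \<in> l2_space" "g \<in> l2_space"
  shows "(\<lambda>i. l2_inner f (e i) * cnj (l2_inner g (e i))) sums l2_inner f g"
proof -
  have e: "l2_orthonormal UNIV e" "l2_total (range e)" using l2_orthonormal_basisD[OF assms(1)] .
  then have eV: "e i \<in> l2_space" for i by (auto simp: l2_orthonormal_def)
  have "(\<lambda>N. l2_inner (\<lambda>x. \<Sum>i<N. l2_inner f (e i) * e i x) g) \<longlonglongrightarrow> l2_inner f g"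
    by (rule l2_inner_tendsto[OF _ _ _ l2_expansion[OF e assms(2)]]) (use eV assms in simp_all)
  moreover have "l2_inner (\<lambda>x. \<Sum>i<N. l2_inner f (e i) * e i x) g =
      (\<Sum>i<N. l2_inner f (e i) * cnj (l2_inner g (e i)))" for N
    using eV assms by (simp add: l2_inner_simps l2_inner_commute[of "e _" g])
  ultimately show ?thesis by (simp add: sums_def)
qed

text \<open>A maximal orthonormal set with property \<open>P\<close> must be total, for otherwise
  \<open>step\<close> would enlarge it. Being countable and infinite, it can be enumerated by the
  natural numbers. The condition \<open>P\<close> is instantiated by eigenfunctions for the spectral
  theorem, and by truth for the mere existence of a basis.\<close>

lemma l2_orthonormal_basis_exists:
  fixes P :: "(real ^ 'd::finite \<Rightarrow> complex) \<Rightarrow> bool"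
  assumes step: "\<And>B f. l2_orthonormal B (\<lambda>b. b) \<Longrightarrow> \<forall>b\<in>B. P b \<Longrightarrow> f \<in> l2_orth B \<Longrightarrow>
    f \<in> l2_nonzero \<Longrightarrow> \<exists>u\<in>l2_orth B. P u \<and> l2_norm u = 1"
  shows "\<exists>e. l2_orthonormal_basis e \<and> (\<forall>i. P (e i))"
proof -
  define \<A> where "\<A> = {B. l2_orthonormal B (\<lambda>b. b) \<and> (\<forall>b\<in>B. P b)}"
  have "\<exists>M\<in>\<A>. \<forall>X\<in>\<A>. M \<subseteq> X \<longrightarrow> X = M"
  proof (rule subset_Zorn')
    fix C assume C: "subset.chain \<A> C"
    \<comment> \<open>Orthonormality concerns only two members at a time, and in a chain any two lie
      in a common set.\<close>
    have *: "\<exists>X\<in>C. a \<in> X \<and> b \<in> X" if ab: "a \<in> \<Union>C" "b \<in> \<Union>C" for a b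
    proof -
      obtain X Y where XY: "X \<in> C" "a \<in> X" "Y \<in> C" "b \<in> Y" using ab by blast
      then have "X \<subseteq> Y \<or> Y \<subseteq> X" using C by (auto simp: subset_chain_def)
      with XY show ?thesis by blast
    qed
    have CA: "X \<in> \<A>" if "X \<in> C" for X
      using C that unfolding subset_chain_def by blast
    have "a \<in> l2_space \<and> P a" if "a \<in> \<Union>C" for a
      using that CA unfolding \<A>_def l2_orthonormal_def by blast
    moreover have "l2_inner a b = (if a = b then 1 else 0)" if ab: "a \<in> \<Union>C" "b \<in> \<Union>C" for a b
    proof -
      obtain X where "X \<in> C" "a \<in> X" "b \<in> X" using *[OF ab] by blast
      then show ?thesis using CA[of X] unfolding \<A>_def l2_orthonormal_def by blast
    qed
    ultimately show "\<Union>C \<in> \<A>" unfolding \<A>_def l2_orthonormal_def by blast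
  qed
  then obtain M where M: "M \<in> \<A>" and max: "\<And>X. X \<in> \<A> \<Longrightarrow> M \<subseteq> X \<Longrightarrow> X = M" by blast
  then have on: "l2_orthonormal M (\<lambda>b. b)" and P: "\<forall>b\<in>M. P b" by (auto simp: \<A>_def)
  have "l2_total M"
    unfolding l2_total_def
  proof (rule ballI, rule ccontr)
    fix f assume f: "f \<in> l2_orth M" and "\<not> l2_eq f (\<lambda>x. 0)"
    then have "f \<in> l2_nonzero" by (auto simp: l2_nonzero_def l2_orth_def)
    from step[OF on P f this] obtain u where u: "u \<in> l2_orth M" "P u" "l2_norm u = 1" by blast
    have uV: "u \<in> l2_space" and uM: "\<And>b. b \<in> M \<Longrightarrow> l2_inner u b = 0"
      using u(1) by (auto simp: l2_orth_def)
    have Mu: "\<And>b. b \<in> M \<Longrightarrow> l2_inner b u = 0"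
      using uM l2_inner_commute[of _ u] by simp
    have uu: "l2_inner u u = 1" unfolding l2_inner_self u(3) by simp
    have "u \<notin> M" using uM uu by force
    have "l2_orthonormal (insert u M) (\<lambda>b. b)"
      using on uV uM Mu uu \<open>u \<notin> M\<close> unfolding l2_orthonormal_def by auto
    then have "insert u M \<in> \<A>" using P u(2) by (auto simp: \<A>_def)
    from max[OF this] \<open>u \<notin> M\<close> show False by blast
  qed
  moreover from l2_orthonormal_countable[OF on] l2_total_orthonormal_infinite[OF on this]
  have bij: "bij_betw (from_nat_into M) UNIV M" by (rule bij_betw_from_nat_into)
  ultimately have "l2_total (range (from_nat_into M))" by (simp add: bij_betw_def)
  moreover have in_M: "from_nat_into M i \<in> M" for i using bij by (auto simp: bij_betw_def)
  have "l2_orthonormal UNIV (from_nat_into M)"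
    using on in_M bij unfolding l2_orthonormal_def bij_betw_def inj_def by metis
  ultimately show ?thesis
    using l2_orthonormal_basisI P in_M by blast
qed

section \<open>Compact positive operators\<close>

lemma l2_bounded_linear_space: "l2_bounded_linear T \<Longrightarrow> f \<in> l2_space \<Longrightarrow> T f \<in> l2_space"
  by (auto simp: l2_bounded_linear_def)

lemma l2_bounded_linear_add:
  "l2_bounded_linear T \<Longrightarrow> f \<in> l2_space \<Longrightarrow> g \<in> l2_space \<Longrightarrow>
    l2_eq (T (\<lambda>x. f x + g x)) (\<lambda>x. T f x + T g x)"
  unfolding l2_bounded_linear_def by blast

lemma l2_bounded_linear_scale:
  "l2_bounded_linear T \<Longrightarrow> f \<in> l2_space \<Longrightarrow> l2_eq (T (\<lambda>x. c * f x)) (\<lambda>x. c * T f x)"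
  unfolding l2_bounded_linear_def by blast

lemma l2_bounded_linear_diff_scale:
  assumes T: "l2_bounded_linear T" and f: "f \<in> l2_space" and g: "g \<in> l2_space"
  shows "l2_eq (T (\<lambda>x. f x - c * g x)) (\<lambda>x. T f x - c * T g x)"
proof -
  have "l2_eq (T (\<lambda>x. f x + (- c) * g x)) (\<lambda>x. T f x + T (\<lambda>x. (- c) * g x) x)"
    by (intro l2_bounded_linear_add T f l2_scale g)
  moreover have "l2_eq (T (\<lambda>x. (- c) * g x)) (\<lambda>x. (- c) * T g x)"
    by (intro l2_bounded_linear_scale T g)
  ultimately have "AE x in lborel. T (\<lambda>x. f x + (- c) * g x) x = T f x + (- c) * T g x"
    unfolding l2_eq_def by eventually_elim simp
  then show ?thesis by (simp add: l2_eq_def)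
qed

lemma l2_bounded_linear_bound:
  assumes "l2_bounded_linear T"
  obtains C where "C > 0" "\<And>f. f \<in> l2_space \<Longrightarrow> l2_norm (T f) \<le> C * l2_norm f"
proof -
  obtain C where C: "\<And>f. f \<in> l2_space \<Longrightarrow> l2_norm (T f) \<le> C * l2_norm f"
    using assms unfolding l2_bounded_linear_def by blast
  have "l2_norm (T f) \<le> (\<bar>C\<bar> + 1) * l2_norm f" if "f \<in> l2_space" for f
    using C[OF that] by (rule order_trans) (intro mult_right_mono; simp)
  then show ?thesis by (intro that[of "\<bar>C\<bar> + 1"]) auto
qed

lemma l2_self_adjointD:
  assumes "l2_self_adjoint T"
  shows "l2_bounded_linear T"
    and "f \<in> l2_space \<Longrightarrow> g \<in> l2_space \<Longrightarrow> l2_inner (T f) g = l2_inner f (T g)"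
  using assms unfolding l2_self_adjoint_def by blast+

lemma l2_eigenfunctionD:
  assumes "l2_eigenfunction T c f" "l2_bounded_linear T"
  shows "f \<in> l2_space" "0 < l2_norm f"
    and "g \<in> l2_space \<Longrightarrow> l2_inner (T f) g = c * l2_inner f g"
proof -
  show f: "f \<in> l2_space" "0 < l2_norm f"
    using assms by (auto simp: l2_eigenfunction_def l2_nonzero_iff)
  show "l2_inner (T f) g = c * l2_inner f g" if g: "g \<in> l2_space"
  proof -
    have "l2_inner (T f) g = l2_inner (\<lambda>x. c * f x) g"
      using assms(1) f(1) g l2_bounded_linear_space[OF assms(2) f(1)]
      by (intro l2_inner_cong) (auto simp: l2_eigenfunction_def l2_eq_def)
    then show ?thesis by (simp add: l2_inner_scale_left)
  qed
qed

lemma l2_eigenvalue_nonneg: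
  assumes "l2_eigenfunction T c f" "l2_bounded_linear T" "l2_pos_semidef T"
  shows "c \<in> \<real>" "0 \<le> Re c"
proof -
  note f = l2_eigenfunctionD[OF assms(1,2)]
  define a where "a = (l2_norm f)\<^sup>2"
  have "a > 0" using f(2) by (simp add: a_def)
  have "l2_inner (T f) f = c * complex_of_real a"
    unfolding f(3)[OF f(1)] l2_inner_self a_def ..
  moreover have "l2_inner (T f) f \<in> \<real>" "0 \<le> Re (l2_inner (T f) f)"
    using assms(3) f(1) by (auto simp: l2_pos_semidef_def)
  ultimately have "Im c * a = 0" "0 \<le> Re c * a"
    by (auto simp: complex_is_Real_iff)
  then show "c \<in> \<real>" "0 \<le> Re c"
    using \<open>a > 0\<close> by (auto simp: complex_is_Real_iff zero_le_mult_iff)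
qed

text \<open>Apply positivity of the form to \<open>f - (1 / M) * T f\<close>.\<close>

lemma l2_pos_semidef_norm_le:
  assumes sa: "l2_self_adjoint T" and psd: "l2_pos_semidef T" and f: "f \<in> l2_space"
    and M: "0 < M" "Re (l2_inner (T (T f)) (T f)) \<le> M * (l2_norm (T f))\<^sup>2"
  shows "(l2_norm (T f))\<^sup>2 \<le> M * Re (l2_inner (T f) f)"
proof -
  note T = l2_self_adjointD(1)[OF sa]
  have Tf: "T f \<in> l2_space" and TTf: "T (T f) \<in> l2_space"
    using f by (auto intro: l2_bounded_linear_space[OF T])
  define c where "c = complex_of_real (1 / M)"
  have c_real: "cnj c = c" by (simp add: c_def)
  define u where "u = (\<lambda>x. f x - c * T f x)"
  have u: "u \<in> l2_space" unfolding u_def using f Tf by simp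
  have "l2_inner (T u) u = l2_inner (\<lambda>x. T f x - c * T (T f) x) u"
    unfolding u_def
    by (rule l2_inner_cong[OF l2_bounded_linear_diff_scale[OF T f Tf]])
       (use u f Tf TTf l2_bounded_linear_space[OF T u] in \<open>auto simp: u_def l2_eq_def\<close>)
  also have "\<dots> = l2_inner (T f) f - c * l2_inner (T f) (T f) - c * l2_inner (T (T f)) f
      + c * c * l2_inner (T (T f)) (T f)"
    unfolding u_def using f Tf TTf c_real by (simp add: l2_inner_simps algebra_simps)
  also have "l2_inner (T (T f)) f = l2_inner (T f) (T f)"
    using l2_self_adjointD(2)[OF sa Tf f] .
  finally have "Re (l2_inner (T u) u) = Re (l2_inner (T f) f) - 2 * (1 / M) * (l2_norm (T f))\<^sup>2
      + (1 / M) * ((1 / M) * Re (l2_inner (T (T f)) (T f)))"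
    by (simp add: c_def l2_inner_self del: of_real_power of_real_divide)
  moreover have "0 \<le> Re (l2_inner (T u) u)"
    using psd u by (auto simp: l2_pos_semidef_def)
  \<comment> \<open>The hypothesis on \<open>M\<close> lets the quadratic term absorb one of the two
    copies of \<open>(1 / M) * (l2_norm (T f))\<^sup>2\<close>; the other copy is the claim.\<close>
  moreover have "(1 / M) * Re (l2_inner (T (T f)) (T f)) \<le> (l2_norm (T f))\<^sup>2"
    using M by (simp add: field_simps)
  then have "(1 / M) * ((1 / M) * Re (l2_inner (T (T f)) (T f))) \<le> (1 / M) * (l2_norm (T f))\<^sup>2"
    using M(1) by (intro mult_left_mono) auto
  ultimately have "(1 / M) * (l2_norm (T f))\<^sup>2 \<le> Re (l2_inner (T f) f)" by linarith
  then show ?thesis using M(1) by (simp add: field_simps)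
qed

text \<open>The new eigenfunction is a maximiser of the quadratic form on the unit sphere of the invariant
  subspace orthogonal to \<open>B\<close>.\<close>

lemma l2_eigenfunction_in_orth:
  assumes sa: "l2_self_adjoint T" and psd: "l2_pos_semidef T" and cpt: "l2_compact T"
    and B: "\<forall>b\<in>B. \<exists>c. l2_eigenfunction T (complex_of_real c) b"
    and f: "f \<in> l2_orth B" "f \<in> l2_nonzero"
  shows "\<exists>u\<in>l2_orth B. (\<exists>c. l2_eigenfunction T (complex_of_real c) u) \<and> l2_norm u = 1"
proof -
  note T = l2_self_adjointD(1)[OF sa]
  define W where "W = l2_orth B"
  define q where "q u = Re (l2_inner (T u) u)" for u
  obtain C where C: "C > 0" "\<And>u. u \<in> l2_space \<Longrightarrow> l2_norm (T u) \<le> C * l2_norm u"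
    using l2_bounded_linear_bound[OF T] by blast
  have WV: "u \<in> l2_space" if "u \<in> W" for u using that by (auto simp: W_def l2_orth_def)
  have TV: "T u \<in> l2_space" if "u \<in> l2_space" for u using l2_bounded_linear_space[OF T that] .
  have W_scale: "(\<lambda>x. c * u x) \<in> W" if "u \<in> W" for c u
    using that by (auto simp: W_def l2_orth_def l2_inner_simps)
  \<comment> \<open>The complement of a set of eigenfunctions is invariant: self-adjointness moves
    \<open>T\<close> onto \<open>b\<close>, where it acts as a scalar.\<close>
  have W_T: "T u \<in> W" if u: "u \<in> W" for u
  proof -
    have "l2_inner (T u) b = 0" if b: "b \<in> B" for b
    proof -
      obtain c where eig: "l2_eigenfunction T (complex_of_real c) b" using B b by blast
      note bV = l2_eigenfunctionD[OF eig T]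
      have "l2_inner (T u) b = l2_inner u (T b)"
        by (rule l2_self_adjointD(2)[OF sa WV[OF u] bV(1)])
      also have "\<dots> = cnj (complex_of_real c * l2_inner b u)"
        unfolding l2_inner_commute[of u] bV(3)[OF WV[OF u]] ..
      also have "l2_inner b u = 0"
        unfolding l2_inner_commute[of b] using u b by (auto simp: W_def l2_orth_def)
      finally show ?thesis by simp
    qed
    then show ?thesis using TV[OF WV[OF u]] by (auto simp: W_def l2_orth_def)
  qed
  have q_nonneg: "0 \<le> q u" if "u \<in> l2_space" for u
    using psd that by (auto simp: q_def l2_pos_semidef_def)
  have q_le: "q u \<le> C * (l2_norm u)\<^sup>2" if "u \<in> l2_space" for u
  proof -
    have "q u \<le> l2_norm (T u) * l2_norm u"
      unfolding q_def using l2_Cauchy_Schwarz[OF TV[OF that] that] complex_Re_le_cmod order_trans by blast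
    also have "\<dots> \<le> C * l2_norm u * l2_norm u"
      using C(2)[OF that] by (intro mult_right_mono) auto
    finally show ?thesis by (simp add: power2_eq_square mult.assoc)
  qed
  have q_scale: "q (\<lambda>x. complex_of_real t * u x) = t\<^sup>2 * q u" if u: "u \<in> l2_space" for t u
  proof -
    have "l2_inner (T (\<lambda>x. complex_of_real t * u x)) (\<lambda>x. complex_of_real t * u x) =
        l2_inner (\<lambda>x. complex_of_real t * T u x) (\<lambda>x. complex_of_real t * u x)"
      by (rule l2_inner_cong[OF l2_bounded_linear_scale[OF T u]])
         (use u TV in \<open>auto simp: l2_eq_def\<close>)
    also have "\<dots> = complex_of_real (t\<^sup>2) * l2_inner (T u) u"
      by (simp add: l2_inner_simps power2_eq_square)
    finally show ?thesis unfolding q_def by simp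
  qed
  define S where "S = q ` {u \<in> W. l2_norm u = 1}"
  define M where "M = Sup S"
  define u0 where "u0 = (\<lambda>x. complex_of_real (1 / l2_norm f) * f x)"
  have fpos: "0 < l2_norm f" using f(2) by (simp add: l2_nonzero_iff)
  have u0: "u0 \<in> W" "l2_norm u0 = 1"
    unfolding u0_def using W_scale f(1) fpos unfolding l2_norm_scale
    by (auto simp: W_def simp del: of_real_divide)
  have bdd: "bdd_above S"
    unfolding S_def by (rule bdd_aboveI2[of _ _ C]) (use q_le WV in force)
  have S_le: "q u \<le> M" if "u \<in> W" "l2_norm u = 1" for u
    unfolding M_def using that by (intro cSup_upper bdd) (auto simp: S_def)
  have qM: "q u \<le> M * (l2_norm u)\<^sup>2" if u: "u \<in> W" for u
  proof (cases "l2_norm u = 0")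
    case True
    then show ?thesis using q_le[OF WV[OF u]] by simp
  next
    case False
    then have pos: "0 < l2_norm u" using l2_norm_nonneg[of u] by linarith
    have "q (\<lambda>x. complex_of_real (1 / l2_norm u) * u x) \<le> M"
      using pos by (intro S_le W_scale u) (auto simp: l2_norm_scale simp del: of_real_divide)
    then show ?thesis
      unfolding q_scale[OF WV[OF u]] using pos by (simp add: field_simps)
  qed
  have M0: "0 \<le> M" using S_le[OF u0] q_nonneg[OF WV[OF u0(1)]] by linarith
  \<comment> \<open>A positive \<open>K\<close> above \<open>M\<close> is allowed because
    \<open>M\<close> itself may be zero; the two cases below take \<open>K = 1\<close> and
    \<open>K = M\<close>.\<close>
  have norm_T: "(l2_norm (T u))\<^sup>2 \<le> K * q u" if u: "u \<in> W" and K: "0 < K" "M \<le> K" for u K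
    unfolding q_def
  proof (rule l2_pos_semidef_norm_le[OF sa psd WV[OF u] K(1)])
    show "Re (l2_inner (T (T u)) (T u)) \<le> K * (l2_norm (T u))\<^sup>2"
      using qM[OF W_T[OF u]] mult_right_mono[OF K(2), of "(l2_norm (T u))\<^sup>2"] by (simp add: q_def)
  qed
  show ?thesis
  proof (cases "M = 0")
    case True
    \<comment> \<open>Here the form is at most zero on the unit sphere of \<open>W\<close>, so the
      normalised \<open>f\<close> is already an eigenfunction, with eigenvalue zero.\<close>
    have "(l2_norm (T u0))\<^sup>2 \<le> 1 * q u0" by (rule norm_T) (use u0 True in auto)
    also have "\<dots> \<le> 0" using S_le[OF u0] True by simp
    finally have "l2_norm (T u0) = 0" by simp
    then have "l2_eq (T u0) (\<lambda>x. complex_of_real 0 * u0 x)"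
      using l2_norm_eq_0_iff[OF TV[OF WV[OF u0(1)]]] by simp
    then have "l2_eigenfunction T (complex_of_real 0) u0"
      using u0 WV unfolding l2_eigenfunction_def l2_nonzero_iff by auto
    then show ?thesis using u0 unfolding W_def by blast
  next
    case False
    then have Mpos: "0 < M" using M0 by simp
    have "\<exists>u. u \<in> W \<and> l2_norm u = 1 \<and> M - 1 / real (Suc n) < q u" for n
    proof -
      have "S \<noteq> {}" using u0 by (auto simp: S_def)
      then have "\<exists>s\<in>S. M - 1 / real (Suc n) < s"
        unfolding M_def using bdd by (subst less_cSup_iff[symmetric]) auto
      then show ?thesis by (auto simp: S_def)
    qed
    then obtain F where F: "\<And>n. F n \<in> W" "\<And>n. l2_norm (F n) = 1" "\<And>n. M - 1 / real (Suc n) < q (F n)"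
      by metis
    have FV: "F n \<in> l2_space" for n using WV[OF F(1)] .
    have "(\<forall>i. F i \<in> l2_space) \<and> (\<exists>C. \<forall>i. l2_norm (F i) \<le> C)"
      using FV F(2) by auto
    then obtain g r where g: "g \<in> l2_space" and r: "strict_mono r"
      and lim_g: "(\<lambda>i. l2_norm (\<lambda>x. T (F (r i)) x - g x)) \<longlonglongrightarrow> 0"
      using cpt unfolding l2_compact_def by blast
    define m where "m = complex_of_real M"
    define G where "G i = (\<lambda>x. m * F (r i) x)" for i
    have GV: "G i \<in> l2_space" for i unfolding G_def using FV by simp
    \<comment> \<open>Near-maximality makes the residual of the eigenvalue equation small:
      \<open>norm_T\<close> bounds \<open>(l2_norm (T (F n)))\<^sup>2\<close> by
      \<open>M * q (F n)\<close>, and the three terms collapse to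
      \<open>M * (M - q (F n))\<close>.\<close>
    have resid: "(l2_norm (\<lambda>x. T (F n) x - m * F n x))\<^sup>2 \<le> M / real (Suc n)" for n
    proof -
      have "(l2_norm (\<lambda>x. T (F n) x - m * F n x))\<^sup>2 = (l2_norm (T (F n)))\<^sup>2 - 2 * (M * q (F n)) + M\<^sup>2"
        unfolding l2_norm_diff_scale_power2[OF TV[OF FV] FV] m_def q_def by (simp add: F(2))
      also have "\<dots> \<le> M * (M - q (F n))"
        using norm_T[OF F(1) Mpos order_refl, of n] by (simp add: power2_eq_square algebra_simps)
      also have "\<dots> \<le> M * (1 / real (Suc n))"
        using F(3)[of n] Mpos by (intro mult_left_mono) auto
      finally show ?thesis by simp
    qed
    have "(\<lambda>n. l2_norm (\<lambda>x. T (F n) x - m * F n x)) \<longlonglongrightarrow> 0"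
    proof (rule Lim_null_comparison)
      show "\<forall>\<^sub>F n in sequentially. norm (l2_norm (\<lambda>x. T (F n) x - m * F n x)) \<le> sqrt (M / real (Suc n))"
        using resid by (simp add: real_le_rsqrt)
      have "(\<lambda>n. M / real (Suc n)) \<longlonglongrightarrow> 0"
        using LIMSEQ_inverse_real_of_nat[THEN tendsto_mult_right_zero[of _ _ M]]
        by (simp add: divide_inverse)
      from tendsto_real_sqrt[OF this] show "(\<lambda>n. sqrt (M / real (Suc n))) \<longlonglongrightarrow> 0" by simp
    qed
    from LIMSEQ_subseq_LIMSEQ[OF this r]
    have lim_resid: "(\<lambda>i. l2_norm (\<lambda>x. T (F (r i)) x - G i x)) \<longlonglongrightarrow> 0"
      by (simp add: comp_def G_def)
    \<comment> \<open>Compactness speaks only of the images; the vanishing residual transfers their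
      norm convergence to the scaled maximising sequence.\<close>
    have lim_G: "(\<lambda>i. l2_norm (\<lambda>x. G i x - g x)) \<longlonglongrightarrow> 0"
    proof (rule Lim_null_comparison)
      show "\<forall>\<^sub>F i in sequentially. norm (l2_norm (\<lambda>x. G i x - g x)) \<le>
          l2_norm (\<lambda>x. T (F (r i)) x - G i x) + l2_norm (\<lambda>x. T (F (r i)) x - g x)"
        using l2_norm_triangle_diff[OF GV TV[OF FV] g]
        by (intro always_eventually allI) (subst l2_norm_minus_commute[of "T _"], simp)
      show "(\<lambda>i. l2_norm (\<lambda>x. T (F (r i)) x - G i x) + l2_norm (\<lambda>x. T (F (r i)) x - g x)) \<longlonglongrightarrow> 0"
        using tendsto_add[OF lim_resid lim_g] by simp
    qed
    \<comment> \<open>Positivity of \<open>M\<close> keeps the limit away from zero, so that it can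
      be normalised to an eigenfunction.\<close>
    have norm_g: "l2_norm g = M"
    proof -
      have "l2_norm (G i) = M" for i unfolding G_def l2_norm_scale m_def using F(2) Mpos by simp
      then show ?thesis using l2_norm_tendsto[OF GV g lim_G] by (simp add: LIMSEQ_const_iff)
    qed
    have gW: "g \<in> W"
    proof -
      have "l2_inner g b = 0" if b: "b \<in> B" for b
      proof -
        have bV: "b \<in> l2_space" using B b l2_eigenfunctionD(1)[OF _ T] by blast
        have "l2_inner (G i) b = 0" for i
          using W_scale[OF F(1)] b unfolding G_def by (auto simp: W_def l2_orth_def)
        then show ?thesis
          using l2_inner_tendsto[OF GV g bV lim_G] by (simp add: LIMSEQ_const_iff)
      qed
      then show ?thesis using g by (auto simp: W_def l2_orth_def)
    qed
    \<comment> \<open>\<open>T g\<close> is compared with \<open>m * T (F (r i))\<close>, the image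
      of \<open>G i\<close>, and this in turn with \<open>m * g\<close>.\<close>
    have "l2_norm (\<lambda>x. T g x - m * g x) \<le>
        C * l2_norm (\<lambda>x. G i x - g x) + M * l2_norm (\<lambda>x. T (F (r i)) x - g x)" for i
    proof -
      have "l2_eq (T (\<lambda>x. g x - m * F (r i) x)) (\<lambda>x. T g x - m * T (F (r i)) x)"
        by (rule l2_bounded_linear_diff_scale[OF T g FV])
      then have "l2_norm (\<lambda>x. T g x - m * T (F (r i)) x) = l2_norm (T (\<lambda>x. g x - G i x))"
        unfolding G_def using TV g FV by (intro l2_norm_cong[symmetric]) auto
      also have "\<dots> \<le> C * l2_norm (\<lambda>x. g x - G i x)" using GV g by (intro C(2)) auto
      finally have *: "l2_norm (\<lambda>x. T g x - m * T (F (r i)) x) \<le> C * l2_norm (\<lambda>x. G i x - g x)"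
        by (simp add: l2_norm_minus_commute)
      have "l2_norm (\<lambda>x. m * T (F (r i)) x - m * g x) = M * l2_norm (\<lambda>x. T (F (r i)) x - g x)"
        using l2_norm_scale[of m "\<lambda>x. T (F (r i)) x - g x"] Mpos by (simp add: right_diff_distrib m_def)
      then show ?thesis
        using * l2_norm_triangle_diff[OF TV[OF g] l2_scale[OF TV[OF FV[of "r i"]]] l2_scale[OF g], of m m]
        by linarith
    qed
    moreover have "(\<lambda>i. C * l2_norm (\<lambda>x. G i x - g x) + M * l2_norm (\<lambda>x. T (F (r i)) x - g x)) \<longlonglongrightarrow> 0"
      using tendsto_add[OF tendsto_mult_right_zero[OF lim_G] tendsto_mult_right_zero[OF lim_g]] by simp
    ultimately have "l2_norm (\<lambda>x. T g x - m * g x) \<le> 0"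
      by (intro LIMSEQ_le_const) auto
    then have "l2_norm (\<lambda>x. T g x - m * g x) = 0" using l2_norm_nonneg order_antisym by blast
    then have eq_g: "l2_eq (T g) (\<lambda>x. m * g x)"
      using TV g by (subst l2_eq_iff_norm_diff) auto
    define u where "u = (\<lambda>x. complex_of_real (1 / M) * g x)"
    have u: "u \<in> W" "l2_norm u = 1"
      unfolding u_def using W_scale[OF gW] norm_g Mpos unfolding l2_norm_scale
      by (auto simp del: of_real_divide)
    have "l2_eq (T u) (\<lambda>x. complex_of_real (1 / M) * T g x)"
      unfolding u_def by (rule l2_bounded_linear_scale[OF T g])
    then have "l2_eq (T u) (\<lambda>x. m * u x)"
      using eq_g unfolding l2_eq_def u_def by eventually_elim simp
    then have "l2_eigenfunction T (complex_of_real M) u"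
      using u WV unfolding l2_eigenfunction_def l2_nonzero_iff m_def by auto
    then show ?thesis using u unfolding W_def by blast
  qed
qed

theorem l2_spectral_theorem:
  assumes sa: "l2_self_adjoint T" and psd: "l2_pos_semidef T" and cpt: "l2_compact T"
  shows "\<exists>\<psi> \<mu>. l2_eigenbasis T \<psi> \<mu>"
proof -
  have "\<exists>e. l2_orthonormal_basis e \<and> (\<forall>i. \<exists>c. l2_eigenfunction T (complex_of_real c) (e i))"
    by (rule l2_orthonormal_basis_exists) (rule l2_eigenfunction_in_orth[OF sa psd cpt])
  then show ?thesis unfolding l2_eigenbasis_def by metis
qed

section \<open>The Rayleigh quotient and the order of the eigenvalues\<close>

text \<open>The concentration ratio with an arbitrary operator in place of the concentration
  operator, so that criticality and the variational principle are consequences of abstract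
  properties alone.\<close>

definition l2_rayleigh ::
    "((real ^ 'd::finite \<Rightarrow> complex) \<Rightarrow> (real ^ 'd \<Rightarrow> complex)) \<Rightarrow> (real ^ 'd \<Rightarrow> complex) \<Rightarrow> real" where
  "l2_rayleigh T f = Re (l2_inner (T f) f / l2_inner f f)"

lemma l2_rayleigh_eq: "l2_rayleigh T f = Re (l2_inner (T f) f) / (l2_norm f)\<^sup>2"
  unfolding l2_rayleigh_def l2_inner_self by (rule Re_divide_of_real)

lemma l2_rayleigh_eigenfunction:
  assumes "l2_eigenfunction T (complex_of_real c) f" "l2_bounded_linear T"
  shows "l2_rayleigh T f = c"
proof -
  note f = l2_eigenfunctionD[OF assms]
  have "Re (l2_inner (T f) f) = c * (l2_norm f)\<^sup>2"
    unfolding f(3)[OF f(1)] l2_inner_self of_real_mult[symmetric] by (rule Re_complex_of_real)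
  then show ?thesis using f(2) by (simp add: l2_rayleigh_eq)
qed

text \<open>The first-order terms of the form and of \<open>m * (l2_norm f)\<^sup>2\<close> cancel, so the quotient differs
  from the eigenvalue \<open>m\<close> by a term quadratic in \<open>h\<close>.\<close>

lemma l2_critical_point_rayleigh:
  assumes sa: "l2_self_adjoint T" and eig: "l2_eigenfunction T (complex_of_real m) f"
  shows "l2_critical_point (l2_rayleigh T) f"
  unfolding l2_critical_point_def
proof (intro conjI allI impI)
  note T = l2_self_adjointD(1)[OF sa]
  note f = l2_eigenfunctionD[OF eig T]
  show "f \<in> l2_nonzero" using f by (simp add: l2_nonzero_iff)
  obtain C where C: "C > 0" "\<And>u. u \<in> l2_space \<Longrightarrow> l2_norm (T u) \<le> C * l2_norm u"
    using l2_bounded_linear_bound[OF T] by blast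
  define a where "a = l2_norm f"
  define D where "D = C + \<bar>m\<bar>"
  have pos: "0 < a" "0 < D" using f(2) C(1) by (auto simp: a_def D_def)
  fix \<epsilon> :: real assume \<epsilon>: "0 < \<epsilon>"
  \<comment> \<open>The first bound keeps the norm of \<open>f + h\<close> above
    \<open>a / 2\<close>; the second makes the quadratic error
    \<open>D * (l2_norm h)\<^sup>2 / (a / 2)\<^sup>2\<close> at most
    \<open>\<epsilon> * l2_norm h\<close>.\<close>
  define \<delta> where "\<delta> = min (a / 2) (\<epsilon> * a\<^sup>2 / (4 * D))"
  have "\<delta> > 0" using pos \<epsilon> by (simp add: \<delta>_def)
  moreover have "\<bar>l2_rayleigh T (\<lambda>x. f x + h x) - l2_rayleigh T f\<bar> \<le> \<epsilon> * l2_norm h"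
    if h: "h \<in> l2_space" and small: "l2_norm h < \<delta>" for h
  proof -
    define k where "k = (\<lambda>x. f x + h x)"
    have k: "k \<in> l2_space" unfolding k_def using f(1) h by simp
    have Tf: "T f \<in> l2_space" and Th: "T h \<in> l2_space" and Tk: "T k \<in> l2_space"
      using l2_bounded_linear_space[OF T] f(1) h k by blast+
    have "a \<le> l2_norm k + l2_norm h"
    proof -
      have "l2_norm (\<lambda>x. k x + (- 1) * h x) \<le> l2_norm k + l2_norm (\<lambda>x. (- 1) * h x)"
        by (intro l2_norm_triangle k l2_scale h)
      then show ?thesis unfolding l2_norm_scale by (simp add: k_def a_def)
    qed
    then have ak: "a / 2 \<le> l2_norm k" using small by (simp add: \<delta>_def)
    have "l2_inner (T k) k = l2_inner (\<lambda>x. T f x + T h x) k"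
      unfolding k_def
      by (rule l2_inner_cong[OF l2_bounded_linear_add[OF T f(1) h]])
         (use Tf Th Tk k in \<open>auto simp: k_def l2_eq_def\<close>)
    also have "\<dots> = l2_inner (T f) f + l2_inner (T f) h + l2_inner (T h) f + l2_inner (T h) h"
      unfolding k_def using Tf Th f(1) h by (simp add: l2_inner_simps)
    also have "l2_inner (T h) f = cnj (l2_inner (T f) h)"
      unfolding l2_self_adjointD(2)[OF sa h f(1)] by (rule l2_inner_commute)
    also have "l2_inner (T f) h = complex_of_real m * l2_inner f h" by (rule f(3)[OF h])
    also have "l2_inner (T f) f = complex_of_real m * l2_inner f f" by (rule f(3)[OF f(1)])
    finally have "Re (l2_inner (T k) k) =
        m * a\<^sup>2 + 2 * m * Re (l2_inner f h) + Re (l2_inner (T h) h)"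
      by (simp add: l2_inner_self a_def del: of_real_power)
    moreover have "(l2_norm k)\<^sup>2 = a\<^sup>2 + 2 * Re (l2_inner f h) + (l2_norm h)\<^sup>2"
      unfolding k_def a_def by (rule l2_norm_add_power2[OF f(1) h])
    ultimately have diff: "Re (l2_inner (T k) k) - m * (l2_norm k)\<^sup>2 =
        Re (l2_inner (T h) h) - m * (l2_norm h)\<^sup>2"
      by (simp add: algebra_simps)
    have "\<bar>Re (l2_inner (T h) h)\<bar> \<le> l2_norm (T h) * l2_norm h"
      using l2_Cauchy_Schwarz[OF Th h] abs_Re_le_cmod order_trans by blast
    also have "\<dots> \<le> C * l2_norm h * l2_norm h"
      using C(2)[OF h] by (intro mult_right_mono) auto
    finally have "\<bar>Re (l2_inner (T h) h)\<bar> \<le> C * (l2_norm h)\<^sup>2"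
      by (simp add: power2_eq_square mult.assoc)
    moreover have "\<bar>m * (l2_norm h)\<^sup>2\<bar> = \<bar>m\<bar> * (l2_norm h)\<^sup>2" by (simp add: abs_mult)
    ultimately have num: "\<bar>Re (l2_inner (T k) k) - m * (l2_norm k)\<^sup>2\<bar> \<le> D * (l2_norm h)\<^sup>2"
      unfolding diff D_def distrib_right by linarith
    have kpos: "0 < (l2_norm k)\<^sup>2" using ak pos by (simp add: zero_less_power2)
    have "l2_rayleigh T k - l2_rayleigh T f = (Re (l2_inner (T k) k) - m * (l2_norm k)\<^sup>2) / (l2_norm k)\<^sup>2"
      unfolding l2_rayleigh_eigenfunction[OF eig T] l2_rayleigh_eq[of T k]
      using kpos by (simp add: diff_divide_distrib)
    then have "\<bar>l2_rayleigh T k - l2_rayleigh T f\<bar> = \<bar>Re (l2_inner (T k) k) - m * (l2_norm k)\<^sup>2\<bar> / (l2_norm k)\<^sup>2"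
      by simp
    also have "\<dots> \<le> (D * (l2_norm h)\<^sup>2) / (a / 2)\<^sup>2"
      using num ak pos by (intro frac_le power_mono) auto
    also have "\<dots> = (4 * D / a\<^sup>2 * l2_norm h) * l2_norm h"
      by (simp add: power2_eq_square)
    also have "\<dots> \<le> \<epsilon> * l2_norm h"
    proof (rule mult_right_mono)
      have "l2_norm h \<le> \<epsilon> * a\<^sup>2 / (4 * D)" using small by (simp add: \<delta>_def)
      then show "4 * D / a\<^sup>2 * l2_norm h \<le> \<epsilon>" using pos by (simp add: field_simps)
    qed simp
    finally show ?thesis by (simp add: k_def)
  qed
  ultimately show "\<exists>\<delta>>0. \<forall>h\<in>l2_space. l2_norm h < \<delta> \<longrightarrow>
      \<bar>l2_rayleigh T (\<lambda>x. f x + h x) - l2_rayleigh T f\<bar> \<le> \<epsilon> * l2_norm h"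
    by blast
qed

section \<open>The quadratic form in an eigenbasis\<close>

lemma l2_Parseval_norm:
  assumes "l2_orthonormal_basis e" "f \<in> l2_space"
  shows "(\<lambda>i. (cmod (l2_inner f (e i)))\<^sup>2) sums (l2_norm f)\<^sup>2"
  using sums_Re[OF l2_Parseval[OF assms assms(2)]]
  unfolding complex_norm_square[symmetric] l2_inner_self Re_complex_of_real .

text \<open>The operator acts diagonally on coefficients: self-adjointness moves it onto
  \<open>\<psi> i\<close>, and the conjugate that appears is harmless because \<open>\<mu> i\<close>
  is real.\<close>

lemma l2_eigenbasis_coeff:
  assumes sa: "l2_self_adjoint T" and eb: "l2_eigenbasis T \<psi> \<mu>" and f: "f \<in> l2_space"
  shows "l2_inner (T f) (\<psi> i) = complex_of_real (\<mu> i) * l2_inner f (\<psi> i)"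
proof -
  have eig: "l2_eigenfunction T (complex_of_real (\<mu> i)) (\<psi> i)"
    using eb by (auto simp: l2_eigenbasis_def)
  note V = l2_eigenfunctionD[OF eig l2_self_adjointD(1)[OF sa]]
  have "l2_inner (T f) (\<psi> i) = cnj (l2_inner (T (\<psi> i)) f)"
    unfolding l2_self_adjointD(2)[OF sa f V(1)] by (rule l2_inner_commute)
  also have "\<dots> = complex_of_real (\<mu> i) * cnj (l2_inner (\<psi> i) f)"
    unfolding V(3)[OF f] by simp
  finally show ?thesis unfolding l2_inner_commute[of f "\<psi> i"] .
qed

lemma l2_eigenbasis_form_sums:
  assumes sa: "l2_self_adjoint T" and eb: "l2_eigenbasis T \<psi> \<mu>" and f: "f \<in> l2_space"
  shows "(\<lambda>i. \<mu> i * (cmod (l2_inner f (\<psi> i)))\<^sup>2) sums Re (l2_inner (T f) f)"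
proof -
  have "l2_orthonormal_basis \<psi>" using eb by (simp add: l2_eigenbasis_def)
  from sums_Re[OF l2_Parseval[OF this l2_bounded_linear_space[OF l2_self_adjointD(1)[OF sa] f] f]]
  show ?thesis
    unfolding l2_eigenbasis_coeff[OF sa eb f] mult.assoc complex_norm_square[symmetric]
      of_real_mult[symmetric] Re_complex_of_real .
qed

lemma l2_eigenbasis_nonneg:
  assumes "l2_self_adjoint T" "l2_pos_semidef T" "l2_eigenbasis T \<psi> \<mu>"
  shows "0 \<le> \<mu> i"
proof -
  have "l2_eigenfunction T (complex_of_real (\<mu> i)) (\<psi> i)"
    using assms(3) by (auto simp: l2_eigenbasis_def)
  from l2_eigenvalue_nonneg(2)[OF this l2_self_adjointD(1)[OF assms(1)] assms(2)]
  show ?thesis by simp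
qed

text \<open>Form and squared norm are sums of \<open>\<mu> i * c f i\<close> and
  \<open>c f i\<close>. On \<open>A n\<close> the coefficients at \<open>\<sigma> m\<close> with
  \<open>m < n\<close> vanish, and every other eigenvalue is at most
  \<open>\<mu> (\<sigma> n)\<close>: it is listed at \<open>n\<close> or later, or unlisted and
  hence zero. Equality of the sums forces equality term by term, so \<open>f\<close> has
  coefficients only where the eigenvalue is \<open>\<mu> (\<sigma> n)\<close>.\<close>

theorem l2_variational_principle:
  assumes sa: "l2_self_adjoint T" and psd: "l2_pos_semidef T" and eb: "l2_eigenbasis T \<psi> \<mu>"
    and \<sigma>: "decreasing_order \<mu> \<sigma>"
  defines "A \<equiv> \<lambda>n. l2_nonzero \<inter> l2_orth ((\<psi> \<circ> \<sigma>) ` {..<n})"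
  shows "\<psi> (\<sigma> n) \<in> A n"
    and "l2_rayleigh T (\<psi> (\<sigma> n)) = \<mu> (\<sigma> n)"
    and "f \<in> A n \<Longrightarrow> l2_rayleigh T f \<le> \<mu> (\<sigma> n)"
    and "f \<in> A n \<Longrightarrow> l2_rayleigh T f = \<mu> (\<sigma> n) \<Longrightarrow>
      l2_eigenfunction T (complex_of_real (\<mu> (\<sigma> n))) f"
proof -
  note T = l2_self_adjointD(1)[OF sa]
  have basis: "l2_orthonormal_basis \<psi>"
    and eig: "\<And>i. l2_eigenfunction T (complex_of_real (\<mu> i)) (\<psi> i)"
    using eb by (auto simp: l2_eigenbasis_def)
  have inj: "inj \<sigma>" and zero: "\<And>i. i \<notin> range \<sigma> \<Longrightarrow> \<mu> i = 0"
    and dec: "\<And>m n. m \<le> n \<Longrightarrow> \<mu> (\<sigma> n) \<le> \<mu> (\<sigma> m)"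
    using \<sigma> by (auto simp: decreasing_order_def decseq_def)
  show "l2_rayleigh T (\<psi> (\<sigma> n)) = \<mu> (\<sigma> n)"
    by (rule l2_rayleigh_eigenfunction[OF eig T])
  have "l2_inner (\<psi> (\<sigma> n)) (\<psi> (\<sigma> m)) = 0" if "m < n" for m
  proof -
    have "\<sigma> n \<noteq> \<sigma> m" using that inj by (auto dest: injD)
    then show ?thesis using basis by (simp add: l2_orthonormal_basis_def)
  qed
  then show "\<psi> (\<sigma> n) \<in> A n"
    using eig[of "\<sigma> n"] l2_eigenfunctionD(1)[OF eig T]
    by (auto simp: A_def l2_orth_def l2_eigenfunction_def)
  define c where "c f i = (cmod (l2_inner f (\<psi> i)))\<^sup>2" for f i
  have term_le: "\<mu> i * c f i \<le> \<mu> (\<sigma> n) * c f i" if f: "f \<in> A n" for f i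
  proof (cases "\<exists>m<n. i = \<sigma> m")
    case True
    then have "c f i = 0" using f by (auto simp: A_def l2_orth_def c_def)
    then show ?thesis by simp
  next
    case False
    have "\<mu> i \<le> \<mu> (\<sigma> n)"
    proof (cases "i \<in> range \<sigma>")
      case True
      then obtain m where m: "i = \<sigma> m" by blast
      with False have "n \<le> m" by (auto simp: not_less[symmetric])
      then show ?thesis using dec m by simp
    qed (use zero l2_eigenbasis_nonneg[OF sa psd eb] in simp)
    then show ?thesis by (intro mult_right_mono) (simp_all add: c_def)
  qed
  have form: "(\<lambda>i. \<mu> i * c f i) sums Re (l2_inner (T f) f)"
    and norm: "(\<lambda>i. \<mu> (\<sigma> n) * c f i) sums (\<mu> (\<sigma> n) * (l2_norm f)\<^sup>2)" if f: "f \<in> l2_space" for f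
    unfolding c_def
    by (rule l2_eigenbasis_form_sums[OF sa eb f], rule sums_mult[OF l2_Parseval_norm[OF basis f]])
  have AV: "f \<in> l2_space" "0 < l2_norm f" if "f \<in> A n" for f
    using that by (auto simp: A_def l2_nonzero_iff)
  show "l2_rayleigh T f \<le> \<mu> (\<sigma> n)" if f: "f \<in> A n"
    using sums_le[OF term_le[OF f] form[OF AV(1)[OF f]] norm[OF AV(1)[OF f]]] AV(2)[OF f]
    by (simp add: l2_rayleigh_eq divide_le_eq)
  show "l2_eigenfunction T (complex_of_real (\<mu> (\<sigma> n))) f"
    if f: "f \<in> A n" and eq: "l2_rayleigh T f = \<mu> (\<sigma> n)"
  proof -
    note fV = AV[OF f]
    have "Re (l2_inner (T f) f) = \<mu> (\<sigma> n) * (l2_norm f)\<^sup>2"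
      using eq fV(2) by (simp add: l2_rayleigh_eq divide_eq_eq)
    then have "(\<lambda>i. \<mu> (\<sigma> n) * c f i - \<mu> i * c f i) sums 0"
      using sums_diff[OF norm[OF fV(1)] form[OF fV(1)]] by simp
    then have zero_term: "\<mu> (\<sigma> n) * c f i - \<mu> i * c f i = 0" for i
      using term_le[OF f] suminf_eq_zero_iff[of "\<lambda>i. \<mu> (\<sigma> n) * c f i - \<mu> i * c f i"]
      by (auto simp: sums_iff)
    define r where "r = (\<lambda>x. T f x - complex_of_real (\<mu> (\<sigma> n)) * f x)"
    have Tf: "T f \<in> l2_space" by (rule l2_bounded_linear_space[OF T fV(1)])
    have r: "r \<in> l2_space" unfolding r_def using Tf fV(1) by simp
    have "l2_inner r (\<psi> i) = 0" for i
    proof -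
      have "l2_inner r (\<psi> i) = (complex_of_real (\<mu> i) - complex_of_real (\<mu> (\<sigma> n))) * l2_inner f (\<psi> i)"
        unfolding r_def using Tf fV(1) l2_eigenfunctionD(1)[OF eig T, of i]
        by (simp add: l2_inner_simps l2_eigenbasis_coeff[OF sa eb fV(1)] left_diff_distrib)
      moreover have "\<mu> i = \<mu> (\<sigma> n) \<or> l2_inner f (\<psi> i) = 0"
        using zero_term[of i] by (auto simp: c_def left_diff_distrib[symmetric])
      ultimately show ?thesis by auto
    qed
    then have "l2_norm r = 0"
      using l2_Parseval_norm[OF basis r] by (simp add: sums_iff)
    then have "l2_eq (T f) (\<lambda>x. complex_of_real (\<mu> (\<sigma> n)) * f x)"
      using Tf fV(1) unfolding r_def by (subst l2_eq_iff_norm_diff) auto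
    then show ?thesis using f by (simp add: l2_eigenfunction_def A_def)
  qed
qed

text \<open>Indices are ranked by decreasing value and, among equal values, by size; restricted to \<open>S\<close> this
  linear order has finite initial segments.\<close>

lemma decreasing_order_exists:
  fixes \<mu> :: "nat \<Rightarrow> real"
  assumes nonneg: "\<And>i. 0 \<le> \<mu> i" and lim: "\<mu> \<longlonglongrightarrow> 0"
  shows "\<exists>\<sigma>. decreasing_order \<mu> \<sigma> \<and> (surj \<sigma> \<or> (\<forall>n. 0 < \<mu> (\<sigma> n)))"
proof -
  define P where "P = {i. 0 < \<mu> i}"
  \<comment> \<open>Infinitely many positive values would leave no room for the zeros, so then only
    the positive ones are listed. Otherwise every index is listed: finitely many positive values
    come first and the zeros follow by size of index.\<close>
  define S where "S = (if infinite P then P else UNIV)"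
  have "infinite S" by (simp add: S_def)
  have PS: "P \<subseteq> S" by (simp add: S_def)
  define prec where "prec j i \<longleftrightarrow> \<mu> i < \<mu> j \<or> \<mu> i = \<mu> j \<and> j < i" for i j
  have fin_ge: "finite {j. \<mu> i \<le> \<mu> j}" if pos: "0 < \<mu> i" for i
  proof -
    obtain N where "\<And>n. n \<ge> N \<Longrightarrow> \<mu> n < \<mu> i"
      using order_tendstoD(2)[OF lim pos] by (auto simp: eventually_sequentially)
    then have "{j. \<mu> i \<le> \<mu> j} \<subseteq> {..<N}" by (auto simp: not_le[symmetric])
    then show ?thesis by (rule finite_subset) simp
  qed
  have fin: "finite {j\<in>S. prec j i}" if "i \<in> S" for i
  proof (cases "0 < \<mu> i")
    case True
    show ?thesis by (rule finite_subset[OF _ fin_ge[OF True]]) (auto simp: prec_def)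
  next
    case False
    then have "\<mu> i = 0" using nonneg[of i] by simp
    then have "{j\<in>S. prec j i} \<subseteq> P \<union> {..<i}" by (auto simp: prec_def P_def)
    moreover have "finite P" using False that by (auto simp: S_def P_def split: if_splits)
    ultimately show ?thesis by (auto intro: finite_subset)
  qed
  define r where "r i = card {j\<in>S. prec j i}" for i
  have r_less: "r k < r i" if "k \<in> S" "i \<in> S" "prec k i" for i k
    unfolding r_def by (rule psubset_card_mono[OF fin[OF that(2)]]) (use that in \<open>auto simp: prec_def\<close>)
  have total: "prec k i \<or> prec i k \<or> k = i" for i k by (auto simp: prec_def)
  have inj_r: "inj_on r S"
    by (rule inj_onI) (use r_less total in \<open>metis less_irrefl\<close>)
  \<comment> \<open>Only the order of the ranks matters; enumerating the attained ranks increasingly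
    turns \<open>r\<close> into a listing by all natural numbers.\<close>
  define R where "R = r ` S"
  have "infinite R" unfolding R_def using \<open>infinite S\<close> inj_r by (simp add: finite_image_iff)
  define \<sigma> where "\<sigma> n = inv_into S r (enumerate R n)" for n
  have in_R: "enumerate R n \<in> r ` S" for n
    using enumerate_in_set[OF \<open>infinite R\<close>, of n] by (simp add: R_def)
  have \<sigma>S: "\<sigma> n \<in> S" and r\<sigma>: "r (\<sigma> n) = enumerate R n" for n
    unfolding \<sigma>_def using inv_into_into[OF in_R] f_inv_into_f[OF in_R] by blast+
  have r_mono: "r (\<sigma> m) < r (\<sigma> n)" if "m < n" for m n
    unfolding r\<sigma> by (rule enumerate_mono[OF that \<open>infinite R\<close>])
  have "inj \<sigma>"
    by (rule linorder_injI) (use r_mono in \<open>metis less_irrefl\<close>)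
  have range: "range \<sigma> = S"
  proof
    show "S \<subseteq> range \<sigma>"
    proof
      fix i assume "i \<in> S"
      then obtain m where "enumerate R m = r i" using enumerate_Ex[OF \<open>infinite R\<close>, of "r i"] by (auto simp: R_def)
      then have "\<sigma> m = i" using \<sigma>S[of m] r\<sigma>[of m] \<open>i \<in> S\<close> inj_r by (auto dest: inj_onD)
      then show "i \<in> range \<sigma>" by blast
    qed
  qed (use \<sigma>S in blast)
  have "\<mu> (\<sigma> n) \<le> \<mu> (\<sigma> m)" if "m \<le> n" for m n
  proof (rule ccontr)
    assume "\<not> ?thesis"
    then have "prec (\<sigma> n) (\<sigma> m)" by (simp add: prec_def)
    from r_less[OF \<sigma>S \<sigma>S this] have "r (\<sigma> n) < r (\<sigma> m)" .
    moreover have "r (\<sigma> m) \<le> r (\<sigma> n)" using that r_mono[of m n] by (cases "m = n") auto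
    ultimately show False by simp
  qed
  then have "decseq (\<mu> \<circ> \<sigma>)" by (simp add: decseq_def)
  moreover have "{i. \<mu> i \<noteq> 0} \<subseteq> range \<sigma>"
    unfolding range using PS nonneg by (force simp: P_def less_le)
  ultimately have "decreasing_order \<mu> \<sigma>" using \<open>inj \<sigma>\<close> by (simp add: decreasing_order_def)
  moreover have "surj \<sigma> \<or> (\<forall>n. 0 < \<mu> (\<sigma> n))"
    using range \<sigma>S by (auto simp: S_def P_def split: if_splits)
  ultimately show ?thesis by blast
qed

text \<open>For \<open>n \<ge> 2 * N\<close> the block from \<open>N\<close> to \<open>n\<close>
  contains at least half of the first \<open>Suc n\<close> indices, and each of its terms is at
  least \<open>a n\<close>. The Cauchy condition makes the sum over the block small.\<close>

lemma decseq_summable_imp_mult_tendsto_0: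
  fixes a :: "nat \<Rightarrow> real"
  assumes dec: "decseq a" and nonneg: "\<And>n. 0 \<le> a n" and sum: "summable a"
  shows "(\<lambda>n. real (Suc n) * a n) \<longlonglongrightarrow> 0"
proof (rule LIMSEQ_I)
  fix \<epsilon> :: real assume "0 < \<epsilon>"
  then obtain N where N: "\<And>m n. m \<ge> N \<Longrightarrow> norm (sum a {m..<n}) < \<epsilon> / 2"
    using sum unfolding summable_Cauchy by (meson half_gt_zero)
  have "norm (real (Suc n) * a n - 0) < \<epsilon>" if n: "n \<ge> 2 * N" for n
  proof -
    have "real (Suc n - N) * a n = (\<Sum>i\<in>{N..<Suc n}. a n)" by simp
    also have "\<dots> \<le> sum a {N..<Suc n}"
      by (rule sum_mono) (use dec in \<open>auto simp: decseq_def\<close>)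
    also have "\<dots> < \<epsilon> / 2" using N[of N "Suc n"] by simp
    finally have "2 * (real (Suc n - N) * a n) < \<epsilon>" by simp
    moreover have "real (Suc n) * a n \<le> (2 * real (Suc n - N)) * a n"
      using n by (intro mult_right_mono nonneg) (simp add: of_nat_diff)
    ultimately show ?thesis using nonneg[of n] by simp
  qed
  then show "\<exists>N. \<forall>n\<ge>N. norm (real (Suc n) * a n - 0) < \<epsilon>" by blast
qed

text \<open>The preceding estimate is applied to the squares, whose summability survives the
  injective reindexing, and a square root is taken. The comparison uses \<open>Suc n\<close> because
  position \<open>n\<close> holds the eigenvalue number \<open>n + 1\<close>.\<close>

lemma decreasing_order_smallo:
  assumes nonneg: "\<And>i. 0 \<le> \<mu> i" and sum: "summable (\<lambda>i. (\<mu> i)\<^sup>2)" and \<sigma>: "decreasing_order \<mu> \<sigma>"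
  shows "(\<lambda>n. \<mu> (\<sigma> n)) \<in> o(\<lambda>n. real (Suc n) powr (- 1 / 2))"
proof (rule smalloI_tendsto)
  have "summable (\<lambda>n. (\<mu> (\<sigma> n))\<^sup>2)"
    using summable_reindex[OF sum, of \<sigma>] \<sigma> by (simp add: decreasing_order_def comp_def)
  moreover have "decseq (\<lambda>n. (\<mu> (\<sigma> n))\<^sup>2)"
    using \<sigma> nonneg by (auto simp: decreasing_order_def decseq_def intro!: power_mono)
  ultimately have "(\<lambda>n. real (Suc n) * (\<mu> (\<sigma> n))\<^sup>2) \<longlonglongrightarrow> 0"
    by (intro decseq_summable_imp_mult_tendsto_0) auto
  from tendsto_real_sqrt[OF this]
  have "(\<lambda>n. sqrt (real (Suc n)) * \<mu> (\<sigma> n)) \<longlonglongrightarrow> 0"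
    using nonneg by (simp add: real_sqrt_mult)
  moreover have "\<mu> (\<sigma> n) / real (Suc n) powr (- 1 / 2) = sqrt (real (Suc n)) * \<mu> (\<sigma> n)" for n
    by (simp add: powr_minus_divide powr_half_sqrt)
  ultimately show "(\<lambda>n. \<mu> (\<sigma> n) / real (Suc n) powr (- 1 / 2)) \<longlonglongrightarrow> 0" by simp
qed simp

section \<open>Weak compactness and integral kernels\<close>

lemma l2_dominated:
  assumes m: "m \<in> l2_space" and g [measurable]: "g \<in> borel_measurable borel"
    and C: "0 \<le> C" and le: "\<And>x. cmod (g x) \<le> C * cmod (m x)"
  shows "g \<in> l2_space" "l2_norm g \<le> C * l2_norm m"
proof -
  note m_int = integrable_mult_right[OF l2_integrable_norm2[OF m], of "C\<^sup>2"]
  have le2: "(cmod (g x))\<^sup>2 \<le> C\<^sup>2 * (cmod (m x))\<^sup>2" for x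
    using power_mono[OF le[of x], of 2] by (simp add: power_mult_distrib)
  show *: "g \<in> l2_space"
    by (rule l2_spaceI[OF g], rule Bochner_Integration.integrable_bound[OF m_int]) (auto simp: le2)
  have "(l2_norm g)\<^sup>2 \<le> (LINT x|lborel. C\<^sup>2 * (cmod (m x))\<^sup>2)"
    unfolding l2_norm_power2 by (intro integral_mono le2 l2_integrable_norm2 * m_int)
  then have "(l2_norm g)\<^sup>2 \<le> (C * l2_norm m)\<^sup>2"
    by (simp add: power_mult_distrib l2_norm_power2)
  then show "l2_norm g \<le> C * l2_norm m"
    by (rule power2_le_imp_le) (use C in simp)
qed

lemma l2_basis_exists: "\<exists>e. l2_orthonormal_basis (e :: nat \<Rightarrow> real ^ 'd::finite \<Rightarrow> complex)"
proof -
  have "\<exists>e :: nat \<Rightarrow> real ^ 'd \<Rightarrow> complex. l2_orthonormal_basis e \<and> (\<forall>i. (\<lambda>_. True) (e i))"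
  proof (rule l2_orthonormal_basis_exists)
    fix B and f :: "real ^ 'd \<Rightarrow> complex"
    assume f: "f \<in> l2_orth B" "f \<in> l2_nonzero"
    define u where "u = (\<lambda>x. complex_of_real (1 / l2_norm f) * f x)"
    have "u \<in> l2_orth B"
      using f(1) unfolding u_def
      by (auto simp: l2_orth_def l2_inner_simps simp del: of_real_divide)
    moreover have "l2_norm u = 1"
      using f(2) unfolding u_def l2_norm_scale l2_nonzero_iff by (auto simp del: of_real_divide)
    ultimately show "\<exists>u\<in>l2_orth B. True \<and> l2_norm u = 1" by blast
  qed
  then show ?thesis by blast
qed

text \<open>A diagonal selection makes the coefficients along one fixed basis converge; since finite
  combinations are dense and the norms are bounded, an estimate in three parts extends this to every
  \<open>u\<close>. Only scalar sequences are said to converge; no weak limit is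
  constructed.\<close>

lemma l2_weakly_convergent_subsequence:
  fixes F :: "nat \<Rightarrow> real ^ 'd::finite \<Rightarrow> complex"
  assumes F: "\<And>n. F n \<in> l2_space" and C: "\<And>n. l2_norm (F n) \<le> C"
  shows "\<exists>r :: nat \<Rightarrow> nat. strict_mono r \<and>
    (\<forall>u\<in>l2_space. convergent (\<lambda>n. l2_inner (F (r n)) u))"
proof -
  obtain e :: "nat \<Rightarrow> real ^ 'd \<Rightarrow> complex" where basis: "l2_orthonormal_basis e"
    using l2_basis_exists by blast
  have eV: "e i \<in> l2_space" and e1: "l2_norm (e i) = 1" for i
    using l2_orthonormal_norm[OF l2_orthonormal_basisD(1)[OF basis]] basis
    by (auto simp: l2_orthonormal_basis_def)
  have inner_le: "cmod (l2_inner (F n) u) \<le> C * l2_norm u" if "u \<in> l2_space" for n u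
    using l2_Cauchy_Schwarz[OF F that] mult_right_mono[OF C l2_norm_nonneg[of u]] order_trans by blast
  obtain r :: "nat \<Rightarrow> nat" where r: "strict_mono r"
    and conv: "\<And>i. \<exists>l. (\<lambda>n. l2_inner (F (r n)) (e i)) \<longlonglongrightarrow> l"
  proof (rule function_convergent_subsequence[of "UNIV :: nat set" "\<lambda>n i. l2_inner (F n) (e i)" C])
    show "norm (l2_inner (F n) (e i)) \<le> C" for n i using inner_le[OF eV] e1 by simp
  qed auto
  have tri: "cmod (a + b - c) \<le> cmod a + cmod b + cmod c" for a b c
    using norm_triangle_ineq4[of "a + b" c] norm_triangle_ineq[of a b] by linarith
  have "C \<ge> 0" using C[of 0] l2_norm_nonneg[of "F 0"] by linarith
  show ?thesis
  proof (intro exI[of _ r] conjI ballI r)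
    fix u :: "real ^ 'd \<Rightarrow> complex" assume u: "u \<in> l2_space"
    have "Cauchy (\<lambda>n. l2_inner (F (r n)) u)"
    proof (rule CauchyI)
      fix \<epsilon> :: real assume "0 < \<epsilon>"
      \<comment> \<open>The summand 1 covers \<open>C = 0\<close> and makes
        \<open>C * \<delta> < \<epsilon> / 3\<close> strict.\<close>
      define \<delta> where "\<delta> = \<epsilon> / (3 * (C + 1))"
      have \<delta>: "0 < \<delta>" "C * \<delta> < \<epsilon> / 3"
        using \<open>0 < \<epsilon>\<close> \<open>C \<ge> 0\<close> by (auto simp: \<delta>_def field_simps)
      obtain N c where less: "l2_norm (\<lambda>x. u x - (\<Sum>i<N. c i * e i x)) < \<delta>"
        using basis u \<delta>(1) unfolding l2_orthonormal_basis_def by meson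
      define p where "p = (\<lambda>x. \<Sum>i<N. c i * e i x)"
      have p: "p \<in> l2_space" unfolding p_def using eV by simp
      have up: "(\<lambda>x. u x - p x) \<in> l2_space" using u p by simp
      have "convergent (\<lambda>n. \<Sum>i<N. cnj (c i) * l2_inner (F (r n)) (e i))"
        using conv by (intro convergent_sum convergent_mult convergent_const) (auto simp: convergent_def)
      then have "convergent (\<lambda>n. l2_inner (F (r n)) p)"
        unfolding p_def using eV F by (simp add: l2_inner_simps)
      then have "Cauchy (\<lambda>n. l2_inner (F (r n)) p)" by (rule convergent_Cauchy)
      from CauchyD[OF this, of "\<epsilon> / 3"] \<open>0 < \<epsilon>\<close>
      obtain M where M: "\<And>m n. m \<ge> M \<Longrightarrow> n \<ge> M \<Longrightarrow>
          cmod (l2_inner (F (r m)) p - l2_inner (F (r n)) p) < \<epsilon> / 3"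
        by auto
      have close: "cmod (l2_inner (F n) u - l2_inner (F n) p) < \<epsilon> / 3" for n
      proof -
        have "cmod (l2_inner (F n) u - l2_inner (F n) p) \<le> C * l2_norm (\<lambda>x. u x - p x)"
          using inner_le[OF up, of n] u p F by (simp add: l2_inner_simps)
        also have "\<dots> \<le> C * \<delta>"
          using less \<open>C \<ge> 0\<close> by (intro mult_left_mono) (auto simp: p_def)
        finally show ?thesis using \<delta>(2) by simp
      qed
      have "cmod (l2_inner (F (r m)) u - l2_inner (F (r n)) u) < \<epsilon>" if "m \<ge> M" "n \<ge> M" for m n
      proof -
        have "cmod (l2_inner (F (r m)) u - l2_inner (F (r n)) u) \<le>
            cmod (l2_inner (F (r m)) u - l2_inner (F (r m)) p)
            + cmod (l2_inner (F (r m)) p - l2_inner (F (r n)) p)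
            + cmod (l2_inner (F (r n)) u - l2_inner (F (r n)) p)"
          using tri[of "l2_inner (F (r m)) u - l2_inner (F (r m)) p"
              "l2_inner (F (r m)) p - l2_inner (F (r n)) p" "l2_inner (F (r n)) u - l2_inner (F (r n)) p"]
          by simp
        then show ?thesis
          using close[of "r m"] close[of "r n"] M[OF that] by linarith
      qed
      then show "\<exists>M. \<forall>m\<ge>M. \<forall>n\<ge>M. norm (l2_inner (F (r m)) u - l2_inner (F (r n)) u) < \<epsilon>"
        by blast
    qed
    then show "convergent (\<lambda>n. l2_inner (F (r n)) u)" by (rule Cauchy_convergent)
  qed
qed

text \<open>The product of \<open>u\<close> and \<open>v\<close> is integrable on the product space
  and dominates the integrand up to \<open>K\<close>. The bounded factor is later the convolution
  kernel, for self-adjointness, or an exponential of modulus one with \<open>K = 1\<close>, for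
  positivity.\<close>

lemma bounded_kernel_Fubini:
  fixes u :: "'a::euclidean_space \<Rightarrow> complex" and v :: "'b::euclidean_space \<Rightarrow> complex"
  assumes \<phi> [measurable]: "case_prod \<phi> \<in> borel_measurable (borel \<Otimes>\<^sub>M borel)"
    and bound: "\<And>x y. cmod (\<phi> x y) \<le> K"
    and u: "integrable lborel u" and v: "integrable lborel v"
  shows "(LINT x|lborel. LINT y|lborel. \<phi> x y * u x * v y) =
    (LINT y|lborel. LINT x|lborel. \<phi> x y * u x * v y)"
proof -
  have [measurable]: "u \<in> borel_measurable borel" "v \<in> borel_measurable borel"
    using u v by (auto dest: borel_measurable_integrable)
  have "integrable (lborel \<Otimes>\<^sub>M lborel) (\<lambda>p. cmod (u (fst p)) * cmod (v (snd p)))"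
  proof (rule lborel_pair.Fubini_integrable)
    show "integrable lborel (\<lambda>x. LINT y|lborel. norm (cmod (u (fst (x, y))) * cmod (v (snd (x, y)))))"
      using u by (simp add: abs_mult)
    show "AE x in lborel. integrable lborel (\<lambda>y. cmod (u (fst (x, y))) * cmod (v (snd (x, y))))"
      using v by simp
  qed measurable
  then have prod: "integrable (lborel \<Otimes>\<^sub>M lborel) (\<lambda>(x, y). K * (cmod (u x) * cmod (v y)))"
    unfolding split_def by (rule integrable_mult_right)
  have "integrable (lborel \<Otimes>\<^sub>M lborel) (\<lambda>(x, y). \<phi> x y * u x * v y)"
  proof (rule Bochner_Integration.integrable_bound[OF prod])
    show "(\<lambda>(x, y). \<phi> x y * u x * v y) \<in> borel_measurable (lborel \<Otimes>\<^sub>M lborel)"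
      unfolding split_def by measurable
    show "AE p in lborel \<Otimes>\<^sub>M lborel. norm (case p of (x, y) \<Rightarrow> \<phi> x y * u x * v y) \<le>
        norm (case p of (x, y) \<Rightarrow> K * (cmod (u x) * cmod (v y)))"
    proof (intro AE_I2)
      fix p :: "'a \<times> 'b"
      obtain x y where p: "p = (x, y)" by (cases p)
      have "cmod (\<phi> x y * u x * v y) = cmod (\<phi> x y) * (cmod (u x) * cmod (v y))"
        by (simp add: norm_mult)
      also have "\<dots> \<le> \<bar>K\<bar> * (cmod (u x) * cmod (v y))"
        using bound[of x y] by (intro mult_right_mono) auto
      finally show "norm (case p of (x, y) \<Rightarrow> \<phi> x y * u x * v y) \<le>
          norm (case p of (x, y) \<Rightarrow> K * (cmod (u x) * cmod (v y)))"
        by (simp add: p abs_mult)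
    qed
  qed
  from lborel_pair.Fubini_integral[OF this] show ?thesis by simp
qed

lemma lborel_integral_uminus:
  fixes f :: "'a::euclidean_space \<Rightarrow> complex"
  assumes [measurable]: "f \<in> borel_measurable borel"
  shows "(LINT x|lborel. f (- x)) = (LINT x|lborel. f x)"
proof -
  have "(lborel :: 'a measure) = distr lborel borel uminus"
    using lborel_affine[of "-1" "0 :: 'a"] by (simp add: density_1)
  then have "(LINT x|lborel. f x) = (LINT x|distr lborel borel uminus. f x)" by simp
  also have "\<dots> = (LINT x|lborel. f (- x))"
    by (rule integral_distr) measurable
  finally show ?thesis by simp
qed

section \<open>The concentration operator\<close>

lemma conc_kernel_eq:
  fixes mF :: "real ^ 'd::finite \<Rightarrow> complex"
  shows "conc_kernel mF z = complex_of_real (1 / (2 * pi) ^ CARD('d)) *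
    (LINT \<xi>|lborel. cis (\<xi> \<bullet> z) * complex_of_real ((cmod (mF \<xi>))\<^sup>2))"
  by (simp add: conc_kernel_def cis_conv_exp)

lemma conc_kernel_measurable [measurable]:
  assumes "mF \<in> l2_space"
  shows "conc_kernel mF \<in> borel_measurable borel"
proof -
  note [measurable] = assms[THEN l2_measurable]
  have [measurable]: "cis \<in> borel_measurable borel"
    by (intro borel_measurable_continuous_onI continuous_intros)
  show ?thesis unfolding conc_kernel_eq[abs_def] by measurable
qed

lemma conc_kernel_bounded:
  fixes mF :: "real ^ 'd::finite \<Rightarrow> complex"
  shows "cmod (conc_kernel mF z) \<le> (l2_norm mF)\<^sup>2 / (2 * pi) ^ CARD('d)"
proof -
  have "cmod (LINT \<xi>|lborel. cis (\<xi> \<bullet> z) * complex_of_real ((cmod (mF \<xi>))\<^sup>2)) \<le>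
      (LINT \<xi>|lborel. cmod (cis (\<xi> \<bullet> z) * complex_of_real ((cmod (mF \<xi>))\<^sup>2)))"
    by (rule integral_norm_bound)
  also have "\<dots> = (l2_norm mF)\<^sup>2"
    by (simp add: norm_mult l2_norm_power2 norm_power)
  finally show ?thesis
    unfolding conc_kernel_eq norm_mult norm_of_real by (simp add: divide_right_mono)
qed

lemma cnj_conc_kernel: "cnj (conc_kernel mF z) = conc_kernel mF (- z)"
proof -
  have "cnj (LINT \<xi>|lborel. cis (\<xi> \<bullet> z) * complex_of_real ((cmod (mF \<xi>))\<^sup>2)) =
      (LINT \<xi>|lborel. cis (\<xi> \<bullet> (- z)) * complex_of_real ((cmod (mF \<xi>))\<^sup>2))"
    unfolding Bochner_Integration.integral_cnj[symmetric] by (simp add: cis_cnj)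
  then show ?thesis unfolding conc_kernel_eq complex_cnj_mult complex_cnj_complex_of_real by simp
qed

text \<open>Each value is an inner product with a section of the kernel, which is what brings
  Cauchy-Schwarz, weak convergence and Bessel's inequality to bear at every single point.\<close>

lemma conc_op_eq_inner:
  "conc_op mS mF f x = cnj (mS x) * l2_inner f (\<lambda>y. cnj (conc_kernel mF (x - y) * mS y))"
  by (simp add: conc_op_def l2_inner_def mult_ac)

lemma conc_kernel_section:
  fixes mS mF :: "real ^ 'd::finite \<Rightarrow> complex"
  assumes mS: "mS \<in> l2_space" and mF: "mF \<in> l2_space"
  defines "K \<equiv> (l2_norm mF)\<^sup>2 / (2 * pi) ^ CARD('d)"
  shows "(\<lambda>y. cnj (conc_kernel mF (x - y) * mS y)) \<in> l2_space"
    and "l2_norm (\<lambda>y. cnj (conc_kernel mF (x - y) * mS y)) \<le> K * l2_norm mS"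
proof -
  note [measurable] = mS[THEN l2_measurable] conc_kernel_measurable[OF mF]
  have "(\<lambda>y. cnj (conc_kernel mF (x - y) * mS y)) \<in> borel_measurable borel" by measurable
  moreover have "0 \<le> K" by (simp add: K_def)
  moreover have "cmod (cnj (conc_kernel mF (x - y) * mS y)) \<le> K * cmod (mS y)" for y
    unfolding complex_mod_cnj norm_mult K_def
    by (intro mult_right_mono conc_kernel_bounded) simp
  ultimately show "(\<lambda>y. cnj (conc_kernel mF (x - y) * mS y)) \<in> l2_space"
    "l2_norm (\<lambda>y. cnj (conc_kernel mF (x - y) * mS y)) \<le> K * l2_norm mS"
    by (rule l2_dominated[OF mS])+
qed

lemma conc_op_pointwise_bound:
  fixes mS mF :: "real ^ 'd::finite \<Rightarrow> complex"
  assumes mS: "mS \<in> l2_space" and mF: "mF \<in> l2_space" and f: "f \<in> l2_space"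
  shows "cmod (conc_op mS mF f x) \<le>
    ((l2_norm mF)\<^sup>2 / (2 * pi) ^ CARD('d) * l2_norm mS * l2_norm f) * cmod (mS x)"
proof -
  have "cmod (l2_inner f (\<lambda>y. cnj (conc_kernel mF (x - y) * mS y))) \<le>
      l2_norm f * ((l2_norm mF)\<^sup>2 / (2 * pi) ^ CARD('d) * l2_norm mS)"
    by (rule order_trans[OF l2_Cauchy_Schwarz[OF f conc_kernel_section(1)[OF mS mF]]])
       (intro mult_left_mono conc_kernel_section(2)[OF mS mF] l2_norm_nonneg)
  from mult_left_mono[OF this norm_ge_zero[of "mS x"]] show ?thesis
    unfolding conc_op_eq_inner norm_mult complex_mod_cnj by (simp add: mult_ac)
qed

lemma conc_op_l2:
  fixes mS mF :: "real ^ 'd::finite \<Rightarrow> complex"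
  assumes mS: "mS \<in> l2_space" and mF: "mF \<in> l2_space" and f: "f \<in> l2_space"
  shows "conc_op mS mF f \<in> l2_space"
    and "l2_norm (conc_op mS mF f) \<le>
      ((l2_norm mF)\<^sup>2 / (2 * pi) ^ CARD('d) * l2_norm mS * l2_norm f) * l2_norm mS"
proof -
  note [measurable] = mS[THEN l2_measurable] f[THEN l2_measurable] conc_kernel_measurable[OF mF]
  have "conc_op mS mF f \<in> borel_measurable borel"
    unfolding conc_op_def[abs_def] by measurable
  then show "conc_op mS mF f \<in> l2_space"
    "l2_norm (conc_op mS mF f) \<le>
      ((l2_norm mF)\<^sup>2 / (2 * pi) ^ CARD('d) * l2_norm mS * l2_norm f) * l2_norm mS"
    by (rule l2_dominated[OF mS _ _ conc_op_pointwise_bound[OF mS mF f]]; simp)+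
qed

lemma conc_op_bounded_linear:
  fixes mS mF :: "real ^ 'd::finite \<Rightarrow> complex"
  assumes mS: "mS \<in> l2_space" and mF: "mF \<in> l2_space"
  shows "l2_bounded_linear (conc_op mS mF)"
  unfolding l2_bounded_linear_def
proof (intro conjI ballI allI)
  note V = conc_kernel_section(1)[OF mS mF]
  fix f :: "real ^ 'd \<Rightarrow> complex" assume f: "f \<in> l2_space"
  show "conc_op mS mF f \<in> l2_space" by (rule conc_op_l2(1)[OF mS mF f])
  show "l2_eq (conc_op mS mF (\<lambda>x. f x + g x)) (\<lambda>x. conc_op mS mF f x + conc_op mS mF g x)"
    if g: "g \<in> l2_space" for g :: "real ^ 'd \<Rightarrow> complex"
    unfolding conc_op_eq_inner l2_inner_add_left[OF f g V] l2_eq_def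
    by (simp add: distrib_left)
  show "l2_eq (conc_op mS mF (\<lambda>x. c * f x)) (\<lambda>x. c * conc_op mS mF f x)" for c
    unfolding conc_op_eq_inner l2_inner_scale_left l2_eq_def by (simp add: mult_ac)
next
  show "\<exists>C. \<forall>f\<in>l2_space. l2_norm (conc_op mS mF f) \<le> C * l2_norm f"
    using conc_op_l2(2)[OF mS mF]
    by (intro exI[of _ "(l2_norm mF)\<^sup>2 / (2 * pi) ^ CARD('d) * l2_norm mS * l2_norm mS"] ballI)
       (simp add: mult_ac)
qed

text \<open>The integrand is grouped as a bounded kernel times two integrable functions, one of each
  variable, to fit \<open>bounded_kernel_Fubini\<close>.\<close>

lemma conc_op_inner:
  assumes mS: "mS \<in> l2_space" and mF: "mF \<in> l2_space" and f: "f \<in> l2_space" and g: "g \<in> l2_space"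
  shows "l2_inner (conc_op mS mF f) g =
    (LINT x|lborel. LINT y|lborel. conc_kernel mF (x - y) * cnj (mS x * g x) * (mS y * f y))"
  unfolding l2_inner_def conc_op_def
proof (rule Bochner_Integration.integral_cong[OF refl])
  fix x
  have "(LINT y|lborel. conc_kernel mF (x - y) * cnj (mS x * g x) * (mS y * f y)) =
      (LINT y|lborel. cnj (mS x * g x) * (conc_kernel mF (x - y) * mS y * f y))"
    by (simp add: mult_ac)
  also have "\<dots> = cnj (mS x * g x) * (LINT y|lborel. conc_kernel mF (x - y) * mS y * f y)"
    by (rule integral_mult_right_zero)
  finally show "cnj (mS x) * (LINT y|lborel. conc_kernel mF (x - y) * mS y * f y) * cnj (g x) =
      (LINT y|lborel. conc_kernel mF (x - y) * cnj (mS x * g x) * (mS y * f y))"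
    by (simp add: mult_ac)
qed

lemma conc_op_self_adjoint:
  fixes mS mF :: "real ^ 'd::finite \<Rightarrow> complex"
  assumes mS: "mS \<in> l2_space" and mF: "mF \<in> l2_space"
  shows "l2_self_adjoint (conc_op mS mF)"
  unfolding l2_self_adjoint_def
proof (intro conjI ballI)
  show "l2_bounded_linear (conc_op mS mF)" by (rule conc_op_bounded_linear[OF mS mF])
  fix f g :: "real ^ 'd \<Rightarrow> complex" assume f: "f \<in> l2_space" and g: "g \<in> l2_space"
  note [measurable] = conc_kernel_measurable[OF mF]
  have "l2_inner f (conc_op mS mF g) = cnj (l2_inner (conc_op mS mF g) f)"
    by (rule l2_inner_commute)
  \<comment> \<open>Conjugation reflects the argument of the kernel and so exchanges the roles of
    \<open>x\<close> and \<open>y\<close>; after renaming, the integrand is that of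
    \<open>l2_inner (conc_op mS mF f) g\<close>, with the integrals in the opposite order.\<close>
  also have "\<dots> = (LINT y|lborel. LINT x|lborel. conc_kernel mF (x - y) * cnj (mS x * g x) * (mS y * f y))"
    unfolding conc_op_inner[OF mS mF g f] Bochner_Integration.integral_cnj[symmetric]
    by (simp add: cnj_conc_kernel mult_ac)
  also have "\<dots> = (LINT x|lborel. LINT y|lborel. conc_kernel mF (x - y) * cnj (mS x * g x) * (mS y * f y))"
    by (rule bounded_kernel_Fubini[symmetric, OF _ conc_kernel_bounded])
       (use l2_integrable_mult[OF mS g] l2_integrable_mult[OF mS f] in
         \<open>auto simp del: complex_cnj_mult intro: Bochner_Integration.integrable_cnj\<close>)
  also have "\<dots> = l2_inner (conc_op mS mF f) g"
    by (rule conc_op_inner[OF mS mF f g, symmetric])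
  finally show "l2_inner (conc_op mS mF f) g = l2_inner f (conc_op mS mF g)" ..
qed

text \<open>Inserting the Fourier integral of the kernel turns the form into the integral of
  \<open>\<bar>mF \<xi>\<bar>\<^sup>2 * \<bar>a (\<xi>)\<bar>\<^sup>2\<close>, where \<open>a\<close> is the Fourier transform of \<open>mS * f\<close>.\<close>

lemma conc_op_form:
  fixes mS mF :: "real ^ 'd::finite \<Rightarrow> complex"
  assumes mS: "mS \<in> l2_space" and mF: "mF \<in> l2_space" and f: "f \<in> l2_space"
  defines "a \<equiv> \<lambda>\<xi>. LINT y|lborel. cis (- (\<xi> \<bullet> y)) * (mS y * f y)"
  shows "l2_inner (conc_op mS mF f) f = complex_of_real
    (1 / (2 * pi) ^ CARD('d) * (LINT \<xi>|lborel. (cmod (mF \<xi>))\<^sup>2 * (cmod (a \<xi>))\<^sup>2))"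
proof -
  note [measurable] = mS[THEN l2_measurable] f[THEN l2_measurable] mF[THEN l2_measurable]
  define \<alpha> where "\<alpha> = complex_of_real (1 / (2 * pi) ^ CARD('d))"
  define w where "w \<xi> = complex_of_real ((cmod (mF \<xi>))\<^sup>2)" for \<xi>
  define h where "h y = mS y * f y" for y
  have h: "integrable lborel h"
    unfolding h_def by (rule l2_integrable_mult[OF mS f])
  have [measurable]: "h \<in> borel_measurable borel" "w \<in> borel_measurable borel"
    unfolding h_def w_def by measurable
  have [measurable]: "cis \<in> borel_measurable borel"
    by (intro borel_measurable_continuous_onI continuous_intros)
  have w: "integrable lborel w"
    unfolding w_def using l2_integrable_norm2[OF mF] by (rule integrable_of_real)
  have a_meas [measurable]: "a \<in> borel_measurable borel"
    unfolding a_def h_def[symmetric] by measurable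
  have a_le: "cmod (a \<xi>) \<le> (LINT y|lborel. cmod (h y))" for \<xi>
    unfolding a_def h_def[symmetric]
    by (rule order_trans[OF integral_norm_bound]) (simp add: norm_mult)
  \<comment> \<open>This product is the second integrable factor when \<open>x\<close> and
    \<open>\<xi>\<close> are exchanged; it is integrable because \<open>a\<close> is bounded by the
    L1 norm of \<open>h\<close>.\<close>
  have wa: "integrable lborel (\<lambda>\<xi>. w \<xi> * a \<xi>)"
  proof (rule Bochner_Integration.integrable_bound)
    show "integrable lborel (\<lambda>\<xi>. (LINT y|lborel. cmod (h y)) * cmod (w \<xi>))" using w by simp
    have "cmod (w \<xi>) * cmod (a \<xi>) \<le> (LINT y|lborel. cmod (h y)) * cmod (w \<xi>)" for \<xi>
      using mult_right_mono[OF a_le[of \<xi>] norm_ge_zero[of "w \<xi>"]] by (simp add: mult.commute)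
    then show "AE \<xi> in lborel. norm (w \<xi> * a \<xi>) \<le> norm ((LINT y|lborel. cmod (h y)) * cmod (w \<xi>))"
      by (simp add: norm_mult abs_mult)
  qed measurable
  \<comment> \<open>After \<open>y\<close> and \<open>\<xi>\<close> are exchanged, the exponential
    at \<open>x - y\<close> splits, and the convolution of the kernel with \<open>h\<close> becomes
    the inverse Fourier transform of \<open>w * a\<close>.\<close>
  have inner: "(LINT y|lborel. conc_kernel mF (x - y) * h y) = \<alpha> * (LINT \<xi>|lborel. cis (\<xi> \<bullet> x) * (w \<xi> * a \<xi>))" for x
  proof -
    have "(LINT y|lborel. conc_kernel mF (x - y) * h y) =
        (LINT y|lborel. \<alpha> * (LINT \<xi>|lborel. cis (\<xi> \<bullet> (x - y)) * h y * w \<xi>))"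
    proof (rule Bochner_Integration.integral_cong[OF refl])
      fix y
      have "(LINT \<xi>|lborel. cis (\<xi> \<bullet> (x - y)) * h y * w \<xi>) =
          (LINT \<xi>|lborel. h y * (cis (\<xi> \<bullet> (x - y)) * w \<xi>))" by (simp add: mult_ac)
      also have "\<dots> = h y * (LINT \<xi>|lborel. cis (\<xi> \<bullet> (x - y)) * w \<xi>)"
        by (rule integral_mult_right_zero)
      finally show "conc_kernel mF (x - y) * h y = \<alpha> * (LINT \<xi>|lborel. cis (\<xi> \<bullet> (x - y)) * h y * w \<xi>)"
        unfolding conc_kernel_eq \<alpha>_def w_def by (simp add: mult_ac)
    qed
    also have "\<dots> = \<alpha> * (LINT y|lborel. LINT \<xi>|lborel. cis (\<xi> \<bullet> (x - y)) * h y * w \<xi>)"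
      by (rule integral_mult_right_zero)
    also have "(LINT y|lborel. LINT \<xi>|lborel. cis (\<xi> \<bullet> (x - y)) * h y * w \<xi>) =
        (LINT \<xi>|lborel. LINT y|lborel. cis (\<xi> \<bullet> (x - y)) * h y * w \<xi>)"
      by (rule bounded_kernel_Fubini[where K = 1, OF _ _ h w]) (simp_all, measurable)
    also have "\<dots> = (LINT \<xi>|lborel. cis (\<xi> \<bullet> x) * (w \<xi> * a \<xi>))"
    proof (rule Bochner_Integration.integral_cong[OF refl])
      fix \<xi>
      have "cis (\<xi> \<bullet> (x - y)) = cis (\<xi> \<bullet> x) * cis (- (\<xi> \<bullet> y))" for y
        by (simp add: inner_diff_right cis_mult)
      then have "(LINT y|lborel. cis (\<xi> \<bullet> (x - y)) * h y * w \<xi>) =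
          (LINT y|lborel. (cis (\<xi> \<bullet> x) * w \<xi>) * (cis (- (\<xi> \<bullet> y)) * h y))"
        by (simp add: mult_ac)
      also have "\<dots> = (cis (\<xi> \<bullet> x) * w \<xi>) * a \<xi>"
        unfolding a_def h_def[symmetric] by (rule integral_mult_right_zero)
      finally show "(LINT y|lborel. cis (\<xi> \<bullet> (x - y)) * h y * w \<xi>) = cis (\<xi> \<bullet> x) * (w \<xi> * a \<xi>)"
        by simp
    qed
    finally show ?thesis .
  qed
  have "l2_inner (conc_op mS mF f) f =
      (LINT x|lborel. LINT y|lborel. cnj (h x) * (conc_kernel mF (x - y) * h y))"
    unfolding conc_op_inner[OF mS mF f f] h_def by (simp add: mult_ac)
  also have "\<dots> = (LINT x|lborel. \<alpha> * (LINT \<xi>|lborel. cis (\<xi> \<bullet> x) * cnj (h x) * (w \<xi> * a \<xi>)))"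
  proof (rule Bochner_Integration.integral_cong[OF refl])
    fix x
    have "(LINT \<xi>|lborel. cis (\<xi> \<bullet> x) * cnj (h x) * (w \<xi> * a \<xi>)) =
        (LINT \<xi>|lborel. cnj (h x) * (cis (\<xi> \<bullet> x) * (w \<xi> * a \<xi>)))" by (simp add: mult_ac)
    also have "\<dots> = cnj (h x) * (LINT \<xi>|lborel. cis (\<xi> \<bullet> x) * (w \<xi> * a \<xi>))"
      by (rule integral_mult_right_zero)
    finally have *: "(LINT \<xi>|lborel. cis (\<xi> \<bullet> x) * cnj (h x) * (w \<xi> * a \<xi>)) =
        cnj (h x) * (LINT \<xi>|lborel. cis (\<xi> \<bullet> x) * (w \<xi> * a \<xi>))" .
    have "(LINT y|lborel. cnj (h x) * (conc_kernel mF (x - y) * h y)) =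
        cnj (h x) * (LINT y|lborel. conc_kernel mF (x - y) * h y)"
      by (rule integral_mult_right_zero)
    then show "(LINT y|lborel. cnj (h x) * (conc_kernel mF (x - y) * h y)) =
        \<alpha> * (LINT \<xi>|lborel. cis (\<xi> \<bullet> x) * cnj (h x) * (w \<xi> * a \<xi>))"
      unfolding inner * by (simp add: mult_ac)
  qed
  also have "\<dots> = \<alpha> * (LINT x|lborel. LINT \<xi>|lborel. cis (\<xi> \<bullet> x) * cnj (h x) * (w \<xi> * a \<xi>))"
    by (rule integral_mult_right_zero)
  \<comment> \<open>The second exchange leaves the exponential to the integral over
    \<open>x\<close>, which then yields \<open>cnj (a \<xi>)\<close> and completes the
    square.\<close>
  also have "(LINT x|lborel. LINT \<xi>|lborel. cis (\<xi> \<bullet> x) * cnj (h x) * (w \<xi> * a \<xi>)) =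
      (LINT \<xi>|lborel. LINT x|lborel. cis (\<xi> \<bullet> x) * cnj (h x) * (w \<xi> * a \<xi>))"
    by (rule bounded_kernel_Fubini[where K = 1, OF _ _ Bochner_Integration.integrable_cnj[OF h] wa])
       (simp_all, measurable)
  also have "\<dots> = (LINT \<xi>|lborel. complex_of_real ((cmod (mF \<xi>))\<^sup>2 * (cmod (a \<xi>))\<^sup>2))"
  proof (rule Bochner_Integration.integral_cong[OF refl])
    fix \<xi>
    have "(LINT x|lborel. cis (\<xi> \<bullet> x) * cnj (h x) * (w \<xi> * a \<xi>)) =
        (LINT x|lborel. (w \<xi> * a \<xi>) * cnj (cis (- (\<xi> \<bullet> x)) * h x))"
      by (simp add: cis_cnj mult_ac)
    also have "\<dots> = (w \<xi> * a \<xi>) * (LINT x|lborel. cnj (cis (- (\<xi> \<bullet> x)) * h x))"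
      by (rule integral_mult_right_zero)
    also have "(LINT x|lborel. cnj (cis (- (\<xi> \<bullet> x)) * h x)) = cnj (a \<xi>)"
      unfolding a_def h_def[symmetric] by (rule Bochner_Integration.integral_cnj)
    finally show "(LINT x|lborel. cis (\<xi> \<bullet> x) * cnj (h x) * (w \<xi> * a \<xi>)) =
        complex_of_real ((cmod (mF \<xi>))\<^sup>2 * (cmod (a \<xi>))\<^sup>2)"
      unfolding w_def of_real_mult complex_norm_square[of "a \<xi>"] by (simp add: mult.assoc)
  qed
  also have "\<dots> = complex_of_real (LINT \<xi>|lborel. (cmod (mF \<xi>))\<^sup>2 * (cmod (a \<xi>))\<^sup>2)"
    by (rule integral_complex_of_real)
  finally show ?thesis unfolding \<alpha>_def of_real_mult .
qed

lemma conc_op_pos_semidef: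
  fixes mS mF :: "real ^ 'd::finite \<Rightarrow> complex"
  assumes "mS \<in> l2_space" "mF \<in> l2_space"
  shows "l2_pos_semidef (conc_op mS mF)"
  unfolding l2_pos_semidef_def
proof (intro ballI conjI)
  fix f :: "real ^ 'd \<Rightarrow> complex" assume f: "f \<in> l2_space"
  show "l2_inner (conc_op mS mF f) f \<in> \<real>"
    unfolding conc_op_form[OF assms f] by (rule Reals_of_real)
  show "0 \<le> Re (l2_inner (conc_op mS mF f) f)"
    unfolding conc_op_form[OF assms f] Re_complex_of_real
    by (intro mult_nonneg_nonneg Bochner_Integration.integral_nonneg) simp_all
qed

text \<open>Along a weakly convergent subsequence the images converge at every point, because each section
  of the kernel is square integrable, and they are dominated by a multiple of \<open>mS\<close>.\<close>

lemma conc_op_compact: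
  fixes mS mF :: "real ^ 'd::finite \<Rightarrow> complex"
  assumes mS: "mS \<in> l2_space" and mF: "mF \<in> l2_space"
  shows "l2_compact (conc_op mS mF)"
  unfolding l2_compact_def
proof (intro conjI allI impI)
  show "l2_bounded_linear (conc_op mS mF)" by (rule conc_op_bounded_linear[OF mS mF])
  fix F :: "nat \<Rightarrow> real ^ 'd \<Rightarrow> complex"
  assume "(\<forall>i. F i \<in> l2_space) \<and> (\<exists>C. \<forall>i. l2_norm (F i) \<le> C)"
  then obtain C where F: "\<And>i. F i \<in> l2_space" and C: "\<And>i. l2_norm (F i) \<le> C" by blast
  obtain r :: "nat \<Rightarrow> nat" where r: "strict_mono r"
    and weak: "\<And>u. u \<in> l2_space \<Longrightarrow> convergent (\<lambda>n. l2_inner (F (r n)) u)"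
    using l2_weakly_convergent_subsequence[of F C, OF F C] by blast
  define T where "T = conc_op mS mF"
  have TV: "T (F i) \<in> l2_space" for i unfolding T_def by (rule conc_op_l2(1)[OF mS mF F])
  note [measurable] = mS[THEN l2_measurable] TV[THEN l2_measurable]
  define D where "D = (l2_norm mF)\<^sup>2 / (2 * pi) ^ CARD('d) * l2_norm mS * C"
  have "0 \<le> C" using C[of 0] l2_norm_nonneg[of "F 0"] by linarith
  then have D: "0 \<le> D" by (simp add: D_def)
  have bound: "cmod (T (F i) x) \<le> D * cmod (mS x)" for i x
    unfolding T_def D_def
    by (rule order_trans[OF conc_op_pointwise_bound[OF mS mF F]])
       (intro mult_right_mono mult_left_mono C; simp)
  define g where "g x = lim (\<lambda>i. T (F (r i)) x)" for x
  have [measurable]: "g \<in> borel_measurable borel"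
    unfolding g_def by (rule borel_measurable_lim_metric) measurable
  have lim: "(\<lambda>i. T (F (r i)) x) \<longlonglongrightarrow> g x" for x
  proof -
    have "convergent (\<lambda>i. T (F (r i)) x)"
      unfolding T_def conc_op_eq_inner
      by (intro convergent_mult convergent_const weak conc_kernel_section(1)[OF mS mF])
    then show ?thesis by (simp only: g_def convergent_LIMSEQ_iff)
  qed
  have g_le: "cmod (g x) \<le> D * cmod (mS x)" for x
    by (rule LIMSEQ_le_const2[OF tendsto_norm[OF lim]]) (use bound in auto)
  have g: "g \<in> l2_space" by (rule l2_dominated(1)[OF mS _ D g_le]) measurable
  have "(\<lambda>i. LINT x|lborel. (cmod (T (F (r i)) x - g x))\<^sup>2) \<longlonglongrightarrow> (LINT x|(lborel :: (real ^ 'd) measure). 0 :: real)"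
  proof (rule integral_dominated_convergence)
    \<comment> \<open>The images and their limit are both bounded by \<open>D * cmod (mS x)\<close>,
      whence the factor 2.\<close>
    show "integrable lborel (\<lambda>x. (2 * D)\<^sup>2 * (cmod (mS x))\<^sup>2)"
      using l2_integrable_norm2[OF mS] by simp
    show "AE x in lborel. (\<lambda>i. (cmod (T (F (r i)) x - g x))\<^sup>2) \<longlonglongrightarrow> 0"
    proof (rule AE_I2)
      fix x
      have "(\<lambda>i. (cmod (T (F (r i)) x - g x))\<^sup>2) \<longlonglongrightarrow> (cmod (g x - g x))\<^sup>2"
        by (intro tendsto_intros lim)
      then show "(\<lambda>i. (cmod (T (F (r i)) x - g x))\<^sup>2) \<longlonglongrightarrow> 0" by simp
    qed
    show "AE x in lborel. norm ((cmod (T (F (r i)) x - g x))\<^sup>2) \<le> (2 * D)\<^sup>2 * (cmod (mS x))\<^sup>2" for i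
    proof (rule AE_I2)
      fix x
      have "cmod (T (F (r i)) x - g x) \<le> 2 * D * cmod (mS x)"
        using norm_triangle_ineq4[of "T (F (r i)) x" "g x"] bound[of "r i" x] g_le[of x] by linarith
      from power_mono[OF this, of 2]
      show "norm ((cmod (T (F (r i)) x - g x))\<^sup>2) \<le> (2 * D)\<^sup>2 * (cmod (mS x))\<^sup>2"
        by (simp add: power_mult_distrib)
    qed
  qed measurable
  then have "(\<lambda>i. LINT x|lborel. (cmod (T (F (r i)) x - g x))\<^sup>2) \<longlonglongrightarrow> 0" by simp
  from tendsto_real_sqrt[OF this]
  have "(\<lambda>i. l2_norm (\<lambda>x. T (F (r i)) x - g x)) \<longlonglongrightarrow> 0" by (simp add: l2_norm_def)
  then show "\<exists>g\<in>l2_space. \<exists>r. strict_mono r \<and>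
      (\<lambda>i. l2_norm (\<lambda>x. conc_op mS mF (F (r i)) x - g x)) \<longlonglongrightarrow> 0"
    using g r unfolding T_def by blast
qed

section \<open>The Hilbert-Schmidt bound and square-summable eigenvalues\<close>

lemma conc_op_summable_norm:
  fixes mS mF :: "real ^ 'd::finite \<Rightarrow> complex"
  assumes mS: "mS \<in> l2_space" and mF: "mF \<in> l2_space" and basis: "l2_orthonormal_basis e"
  shows "summable (\<lambda>i. (l2_norm (conc_op mS mF (e i)))\<^sup>2)"
proof -
  define K where "K = (l2_norm mF)\<^sup>2 / (2 * pi) ^ CARD('d)"
  define v where "v x y = cnj (conc_kernel mF (x - y) * mS y)" for x y
  have v: "v x \<in> l2_space" "l2_norm (v x) \<le> K * l2_norm mS" for x
    unfolding v_def[abs_def] K_def by (rule conc_kernel_section[OF mS mF])+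
  have on: "l2_orthonormal {..<N} e" for N
    using l2_orthonormal_basisD(1)[OF basis] by (auto simp: l2_orthonormal_def)
  have TV: "conc_op mS mF (e i) \<in> l2_space" for i
    using basis by (intro conc_op_l2(1)[OF mS mF]) (auto simp: l2_orthonormal_basis_def)
  show ?thesis
  proof (rule summableI_nonneg_bounded)
    fix N
    have "(\<Sum>i<N. (l2_norm (conc_op mS mF (e i)))\<^sup>2) =
        (LINT x|lborel. (\<Sum>i<N. (cmod (conc_op mS mF (e i) x))\<^sup>2))"
      unfolding l2_norm_power2 using l2_integrable_norm2[OF TV]
      by (intro Bochner_Integration.integral_sum[symmetric])
    also have "\<dots> \<le> (LINT x|lborel. (K * l2_norm mS)\<^sup>2 * (cmod (mS x))\<^sup>2)"
    proof (rule integral_mono)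
      show "integrable lborel (\<lambda>x. \<Sum>i<N. (cmod (conc_op mS mF (e i) x))\<^sup>2)"
        using l2_integrable_norm2[OF TV] by (intro Bochner_Integration.integrable_sum)
      show "integrable lborel (\<lambda>x. (K * l2_norm mS)\<^sup>2 * (cmod (mS x))\<^sup>2)"
        using l2_integrable_norm2[OF mS] by simp
      fix x
      \<comment> \<open>At a fixed \<open>x\<close> the values on the basis are, up to conjugation
        and the factor \<open>mS x\<close>, the coefficients of the section \<open>v x\<close>. The
        resulting bound is independent of \<open>N\<close>, and its integral is
        \<open>K\<^sup>2 * l2_norm mS ^ 4\<close>.\<close>
      have "(\<Sum>i<N. (cmod (conc_op mS mF (e i) x))\<^sup>2) =
          (\<Sum>i<N. (cmod (l2_inner (v x) (e i)))\<^sup>2) * (cmod (mS x))\<^sup>2"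
        unfolding conc_op_eq_inner v_def[symmetric] norm_mult power_mult_distrib sum_distrib_right
          l2_inner_commute[of "e _" "v x"] by (simp add: mult.commute)
      also have "\<dots> \<le> (K * l2_norm mS)\<^sup>2 * (cmod (mS x))\<^sup>2"
        using order_trans[OF l2_Bessel[OF on _ v(1)] power_mono[OF v(2) l2_norm_nonneg]]
        by (intro mult_right_mono) simp_all
      finally show "(\<Sum>i<N. (cmod (conc_op mS mF (e i) x))\<^sup>2) \<le> (K * l2_norm mS)\<^sup>2 * (cmod (mS x))\<^sup>2" .
    qed
    finally show "(\<Sum>i<N. (l2_norm (conc_op mS mF (e i)))\<^sup>2) \<le>
        (LINT x|lborel. (K * l2_norm mS)\<^sup>2 * (cmod (mS x))\<^sup>2)" .
  qed simp
qed

text \<open>The Hilbert-Schmidt sum taken in the eigenbasis itself: each image has norm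
  \<open>\<bar>\<mu> i\<bar>\<close>.\<close>

lemma conc_op_summable_eigenvalues:
  assumes mS: "mS \<in> l2_space" and mF: "mF \<in> l2_space" and eb: "l2_eigenbasis (conc_op mS mF) \<psi> \<mu>"
  shows "summable (\<lambda>i. (\<mu> i)\<^sup>2)"
proof -
  have basis: "l2_orthonormal_basis \<psi>"
    and eig: "\<And>i. l2_eigenfunction (conc_op mS mF) (complex_of_real (\<mu> i)) (\<psi> i)"
    using eb by (auto simp: l2_eigenbasis_def)
  have "(l2_norm (conc_op mS mF (\<psi> i)))\<^sup>2 = (\<mu> i)\<^sup>2" for i
  proof -
    have \<psi>: "\<psi> i \<in> l2_space" using basis by (simp add: l2_orthonormal_basis_def)
    have "l2_norm (conc_op mS mF (\<psi> i)) = l2_norm (\<lambda>x. complex_of_real (\<mu> i) * \<psi> i x)"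
      using eig[of i] \<psi> conc_op_l2(1)[OF mS mF \<psi>]
      by (intro l2_norm_cong) (auto simp: l2_eigenfunction_def)
    also have "\<dots> = \<bar>\<mu> i\<bar>"
      unfolding l2_norm_scale using l2_orthonormal_norm[OF l2_orthonormal_basisD(1)[OF basis]] by simp
    finally show ?thesis by simp
  qed
  then show ?thesis using conc_op_summable_norm[OF mS mF basis] by simp
qed

section \<open>Real-valuedness under symmetry of the masks\<close>

lemma conc_kernel_real:
  assumes mF: "mF \<in> l2_space"
    and even: "AE \<xi> in lborel. (cmod (mF (- \<xi>)))\<^sup>2 = (cmod (mF \<xi>))\<^sup>2"
  shows "cnj (conc_kernel mF z) = conc_kernel mF z"
proof -
  note [measurable] = mF[THEN l2_measurable]
  have [measurable]: "cis \<in> borel_measurable borel"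
    by (intro borel_measurable_continuous_onI continuous_intros)
  \<comment> \<open>Reflecting the frequency variable and using evenness shows that the kernel is
    even; as reflection of its argument amounts to conjugation, it is also real.\<close>
  have "(LINT \<xi>|lborel. cis (\<xi> \<bullet> z) * complex_of_real ((cmod (mF \<xi>))\<^sup>2)) =
      (LINT \<xi>|lborel. cis ((- \<xi>) \<bullet> z) * complex_of_real ((cmod (mF (- \<xi>)))\<^sup>2))"
    by (rule lborel_integral_uminus[symmetric]) measurable
  also have "\<dots> = (LINT \<xi>|lborel. cis (\<xi> \<bullet> (- z)) * complex_of_real ((cmod (mF \<xi>))\<^sup>2))"
  proof (rule integral_cong_AE)
    show "AE \<xi> in lborel. cis ((- \<xi>) \<bullet> z) * complex_of_real ((cmod (mF (- \<xi>)))\<^sup>2) =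
        cis (\<xi> \<bullet> (- z)) * complex_of_real ((cmod (mF \<xi>))\<^sup>2)"
      using even by eventually_elim simp
  qed measurable
  finally show ?thesis unfolding cnj_conc_kernel unfolding conc_kernel_eq by (simp only:)
qed

lemma conc_op_real:
  assumes mS: "mS \<in> l2_space" and mF: "mF \<in> l2_space" and f: "f \<in> l2_space"
    and even: "AE \<xi> in lborel. (cmod (mF (- \<xi>)))\<^sup>2 = (cmod (mF \<xi>))\<^sup>2"
    and mS_real: "AE x in lborel. mS x \<in> \<real>" and f_real: "AE x in lborel. f x \<in> \<real>"
  shows "AE x in lborel. conc_op mS mF f x \<in> \<real>"
  using mS_real
proof eventually_elim
  case (elim x)
  note [measurable] = mS[THEN l2_measurable] f[THEN l2_measurable] conc_kernel_measurable[OF mF]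
  define I where "I = (LINT y|lborel. conc_kernel mF (x - y) * mS y * f y)"
  have "cnj I = (LINT y|lborel. cnj (conc_kernel mF (x - y) * mS y * f y))"
    unfolding I_def by (rule Bochner_Integration.integral_cnj[symmetric])
  also have "\<dots> = I"
    unfolding I_def
  proof (rule integral_cong_AE)
    show "AE y in lborel. cnj (conc_kernel mF (x - y) * mS y * f y) = conc_kernel mF (x - y) * mS y * f y"
      using mS_real f_real
      by eventually_elim (simp add: conc_kernel_real[OF mF even] Reals_cnj_iff)
  qed measurable
  finally have "I \<in> \<real>" by (simp add: Reals_cnj_iff)
  then show ?case
    unfolding conc_op_def I_def[symmetric] using elim by (simp add: Reals_cnj_iff)
qed

theorem proposition1:
  fixes mS mF :: "real ^ 'd::finite \<Rightarrow> complex"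
  assumes "mS \<in> l2_space" and "mF \<in> l2_space"
  shows
    "(l2_hilbert_schmidt (conc_op mS mF) \<and> l2_self_adjoint (conc_op mS mF) \<and>
      l2_compact (conc_op mS mF) \<and> l2_pos_semidef (conc_op mS mF))
   \<and> ((\<exists>\<psi> \<mu>. l2_eigenbasis (conc_op mS mF) \<psi> \<mu>) \<and>
      (\<forall>c f. l2_eigenfunction (conc_op mS mF) c f \<longrightarrow> c \<in> \<real> \<and> 0 \<le> Re c) \<and>
      (\<forall>\<psi> \<mu>. l2_eigenbasis (conc_op mS mF) \<psi> \<mu> \<longrightarrow>
         (\<forall>i. 0 \<le> \<mu> i) \<and>
         (\<exists>\<sigma>. decreasing_order \<mu> \<sigma> \<and> (surj \<sigma> \<or> (\<forall>n. 0 < \<mu> (\<sigma> n))))))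
   \<and> (\<forall>\<psi> \<mu>. l2_eigenbasis (conc_op mS mF) \<psi> \<mu> \<longrightarrow>
        (\<forall>i. l2_critical_point (conc_ratio mS mF) (\<psi> i)) \<and>
        (\<forall>\<sigma>. decreasing_order \<mu> \<sigma> \<longrightarrow>
           (\<forall>n. let A = l2_nonzero \<inter> l2_orth ((\<psi> \<circ> \<sigma>) ` {..<n}) in
              bdd_above (conc_ratio mS mF ` A) \<and>
              \<mu> (\<sigma> n) = (SUP f\<in>A. conc_ratio mS mF f) \<and>
              \<psi> (\<sigma> n) \<in> A \<and> conc_ratio mS mF (\<psi> (\<sigma> n)) = \<mu> (\<sigma> n) \<and>
              (\<forall>f\<in>A. conc_ratio mS mF f = \<mu> (\<sigma> n) \<longrightarrow>
                 l2_eigenfunction (conc_op mS mF) (complex_of_real (\<mu> (\<sigma> n))) f))))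
   \<and> (\<forall>\<psi> \<mu> \<sigma>. l2_eigenbasis (conc_op mS mF) \<psi> \<mu> \<longrightarrow> decreasing_order \<mu> \<sigma> \<longrightarrow>
        (\<lambda>n. \<mu> (\<sigma> n)) \<in> o(\<lambda>n. real (Suc n) powr (- 1 / 2)))
   \<and> ((AE \<xi> in lborel. (cmod (mF (- \<xi>)))\<^sup>2 = (cmod (mF \<xi>))\<^sup>2) \<longrightarrow>
      (AE x in lborel. mS x \<in> \<real>) \<longrightarrow>
      (\<forall>f\<in>l2_space. (AE x in lborel. f x \<in> \<real>) \<longrightarrow>
         (AE x in lborel. conc_op mS mF f x \<in> \<real>)))"
proof -
  define T where "T = conc_op mS mF"
  have T: "l2_bounded_linear T" and sa: "l2_self_adjoint T" and psd: "l2_pos_semidef T"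
    and cpt: "l2_compact T"
    unfolding T_def using conc_op_bounded_linear[OF assms] conc_op_self_adjoint[OF assms]
      conc_op_pos_semidef[OF assms] conc_op_compact[OF assms] .
  have ratio: "conc_ratio mS mF = l2_rayleigh T"
    by (rule ext) (simp add: conc_ratio_def l2_rayleigh_def T_def)
  obtain \<psi>0 \<mu>0 where eb0: "l2_eigenbasis T \<psi>0 \<mu>0"
    using l2_spectral_theorem[OF sa psd cpt] by blast
  then have "l2_orthonormal_basis \<psi>0" by (simp add: l2_eigenbasis_def)
  \<comment> \<open>The Hilbert-Schmidt sum may be taken in any orthonormal basis; the eigenbasis is
    at hand.\<close>
  then have hs: "l2_hilbert_schmidt T"
    unfolding l2_hilbert_schmidt_def using T conc_op_summable_norm[OF assms] unfolding T_def by blast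
  have nonneg: "0 \<le> \<mu> i" if "l2_eigenbasis T \<psi> \<mu>" for \<psi> \<mu> i
    by (rule l2_eigenbasis_nonneg[OF sa psd that])
  have summable: "summable (\<lambda>i. (\<mu> i)\<^sup>2)" if "l2_eigenbasis T \<psi> \<mu>" for \<psi> \<mu>
    by (rule conc_op_summable_eigenvalues[OF assms that[unfolded T_def]])
  have order: "\<exists>\<sigma>. decreasing_order \<mu> \<sigma> \<and> (surj \<sigma> \<or> (\<forall>n. 0 < \<mu> (\<sigma> n)))"
    if eb: "l2_eigenbasis T \<psi> \<mu>" for \<psi> \<mu>
  proof (rule decreasing_order_exists[OF nonneg[OF eb]])
    \<comment> \<open>Square-summability makes the eigenvalues tend to zero, so only finitely many
      exceed a given positive one; the ranking by size depends on this.\<close>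
    from tendsto_real_sqrt[OF summable_LIMSEQ_zero[OF summable[OF eb]]]
    show "\<mu> \<longlonglongrightarrow> 0" using nonneg[OF eb] by simp
  qed
  have crit: "l2_critical_point (l2_rayleigh T) (\<psi> i)" if "l2_eigenbasis T \<psi> \<mu>" for \<psi> \<mu> i
    using that by (intro l2_critical_point_rayleigh[OF sa, of "\<mu> i"]) (simp add: l2_eigenbasis_def)
  have variational: "let A = l2_nonzero \<inter> l2_orth ((\<psi> \<circ> \<sigma>) ` {..<n}) in
      bdd_above (l2_rayleigh T ` A) \<and>
      \<mu> (\<sigma> n) = (SUP f\<in>A. l2_rayleigh T f) \<and>
      \<psi> (\<sigma> n) \<in> A \<and> l2_rayleigh T (\<psi> (\<sigma> n)) = \<mu> (\<sigma> n) \<and>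
      (\<forall>f\<in>A. l2_rayleigh T f = \<mu> (\<sigma> n) \<longrightarrow>
         l2_eigenfunction T (complex_of_real (\<mu> (\<sigma> n))) f)"
    if eb: "l2_eigenbasis T \<psi> \<mu>" and \<sigma>: "decreasing_order \<mu> \<sigma>" for \<psi> \<mu> \<sigma> n
  proof -
    define A where "A = l2_nonzero \<inter> l2_orth ((\<psi> \<circ> \<sigma>) ` {..<n})"
    note vp = l2_variational_principle[where n = n, OF sa psd eb \<sigma>, folded A_def]
    have "bdd_above (l2_rayleigh T ` A)" by (rule bdd_aboveI2[OF vp(3)])
    moreover have "(SUP f\<in>A. l2_rayleigh T f) = \<mu> (\<sigma> n)"
      by (rule cSup_eq_maximum) (use vp(1-3) in \<open>auto intro: rev_image_eqI\<close>)
    ultimately show ?thesis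
      unfolding Let_def A_def[symmetric] using vp(1,2,4) by simp
  qed
  have smallo: "(\<lambda>n. \<mu> (\<sigma> n)) \<in> o(\<lambda>n. real (Suc n) powr (- 1 / 2))"
    if "l2_eigenbasis T \<psi> \<mu>" "decreasing_order \<mu> \<sigma>" for \<psi> \<mu> \<sigma>
    by (rule decreasing_order_smallo[OF nonneg[OF that(1)] summable[OF that(1)] that(2)])
  show ?thesis
    unfolding T_def[symmetric] ratio
  proof (intro conjI)
    show "\<exists>\<psi> \<mu>. l2_eigenbasis T \<psi> \<mu>" using eb0 by blast
    show "\<forall>c f. l2_eigenfunction T c f \<longrightarrow> c \<in> \<real> \<and> 0 \<le> Re c"
      using l2_eigenvalue_nonneg[OF _ T psd] by blast
    show "\<forall>\<psi> \<mu>. l2_eigenbasis T \<psi> \<mu> \<longrightarrow> (\<forall>i. 0 \<le> \<mu> i) \<and>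
        (\<exists>\<sigma>. decreasing_order \<mu> \<sigma> \<and> (surj \<sigma> \<or> (\<forall>n. 0 < \<mu> (\<sigma> n))))"
      using nonneg order by blast
    show "\<forall>\<psi> \<mu>. l2_eigenbasis T \<psi> \<mu> \<longrightarrow>
        (\<forall>i. l2_critical_point (l2_rayleigh T) (\<psi> i)) \<and>
        (\<forall>\<sigma>. decreasing_order \<mu> \<sigma> \<longrightarrow>
           (\<forall>n. let A = l2_nonzero \<inter> l2_orth ((\<psi> \<circ> \<sigma>) ` {..<n}) in
              bdd_above (l2_rayleigh T ` A) \<and>
              \<mu> (\<sigma> n) = (SUP f\<in>A. l2_rayleigh T f) \<and>
              \<psi> (\<sigma> n) \<in> A \<and> l2_rayleigh T (\<psi> (\<sigma> n)) = \<mu> (\<sigma> n) \<and>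
              (\<forall>f\<in>A. l2_rayleigh T f = \<mu> (\<sigma> n) \<longrightarrow>
                 l2_eigenfunction T (complex_of_real (\<mu> (\<sigma> n))) f)))"
      by (intro allI impI conjI crit variational)
    show "\<forall>\<psi> \<mu> \<sigma>. l2_eigenbasis T \<psi> \<mu> \<longrightarrow> decreasing_order \<mu> \<sigma> \<longrightarrow>
        (\<lambda>n. \<mu> (\<sigma> n)) \<in> o(\<lambda>n. real (Suc n) powr (- 1 / 2))"
      by (intro allI impI smallo)
    show "(AE \<xi> in lborel. (cmod (mF (- \<xi>)))\<^sup>2 = (cmod (mF \<xi>))\<^sup>2) \<longrightarrow>
        (AE x in lborel. mS x \<in> \<real>) \<longrightarrow>
        (\<forall>f\<in>l2_space. (AE x in lborel. f x \<in> \<real>) \<longrightarrow> (AE x in lborel. T f x \<in> \<real>))"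
      unfolding T_def by (intro impI ballI conc_op_real[OF assms])
  qed (fact hs sa cpt psd)+
qed

end
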